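(* Let $E$ be a real affine space of finite dimension $n$ and let $\mu\in\mathcal M(E)$. Then there exists a Yao-Yao equipartition for $\mu$. Moreover, if $\mu$ has a center of symmetry $x\in E$ (that is, $\mu$ is invariant under the point reflection of center $x$), then $x$ is a Yao-Yao center for $\mu$.
   Context: $\vec E$ denotes the vector space associated with $E$. A partition of $E$ is a collection $\mathcal P$ of subsets of $E$ with $\bigcup\mathcal P=E$ such that the interiors of any two distinct elements of $\mathcal P$ are disjoint. Yao-Yao partitions and their centers are defined by induction on the dimension: if $E=\{x\}$ has dimension $0$, the Yao-Yao partition of $E$ is $\{\{x\}\}$, with center $x$. If $\dim E=n\ge 1$, $\mathcal P$ is a Yao-Yao partition of $E$ with center $x$ if there exist an affine hyperplane $F$ of $E$, a vector $v\in\vec E\setminus\vec F$ and two Yao-Yao partitions $\mathcal P_1,\mathcal P_{-1}$ of $F$ having the same center $x$, such that $\mathcal P=\{A+\mathbb R_- v : A\in\mathcal P_{-1}\}\cup\{A+\mathbb R_+ v: A\in\mathcal P_1\}$. $\mathcal M(E)$ is the set of finite non-negative Borel measures $\mu$ on $E$ such that $\mu(H)=0$ for every affine hyperplane $H$ of $E$. For $\mu\in\mathcal M(E)$, a Yao-Yao equipartition for $\mu$ is a Yao-Yao partition $\mathcal P$ of $E$ with $\mu(A)=2^{-n}\mu(E)$ for all $A\in\mathcal P$; a point $x\in E$ is a Yao-Yao center of $\mu$ if it is the center of some Yao-Yao equipartition for $\mu$. *)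

theory Defs
  imports "HOL-Analysis.Analysis" "HOL-Probability.Probability"
begin

text \<open>The real affine space E is modelled as a nonempty affine subset of a
Euclidean space 'a (every finite-dimensional real affine space is of this form).\<close>

definition vec_of :: "'a::euclidean_space set \<Rightarrow> 'a set" where
  "vec_of S = {y - z | y z. y \<in> S \<and> z \<in> S}"

definition affine_hyperplane_of :: "'a::euclidean_space set \<Rightarrow> 'a set \<Rightarrow> bool" where
  "affine_hyperplane_of E F \<longleftrightarrow> affine F \<and> F \<subseteq> E \<and> aff_dim F = aff_dim E - 1"

definition ray_sum_neg :: "'a::euclidean_space set \<Rightarrow> 'a \<Rightarrow> 'a set" where
  "ray_sum_neg A v = {a + t *\<^sub>R v | a t. a \<in> A \<and> t \<le> 0}"

definition ray_sum_pos :: "'a::euclidean_space set \<Rightarrow> 'a \<Rightarrow> 'a set" where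
  "ray_sum_pos A v = {a + t *\<^sub>R v | a t. a \<in> A \<and> t \<ge> 0}"

inductive yao_yao :: "'a::euclidean_space set \<Rightarrow> 'a set set \<Rightarrow> 'a \<Rightarrow> bool" where
  base: "yao_yao {x} {{x}} x"
| step: "\<lbrakk> affine E; aff_dim E \<ge> 1; affine_hyperplane_of E F;
          v \<in> vec_of E; v \<notin> vec_of F;
          yao_yao F P1 x; yao_yao F Pm1 x \<rbrakk> \<Longrightarrow>
        yao_yao E ((\<lambda>A. ray_sum_neg A v) ` Pm1 \<union> (\<lambda>A. ray_sum_pos A v) ` P1) x"

definition measures_M :: "'a::euclidean_space set \<Rightarrow> 'a measure set" where
  "measures_M E = {\<mu>. sets \<mu> = sets (restrict_space borel E) \<and> finite_measure \<mu> \<and>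
      (\<forall>H. affine_hyperplane_of E H \<longrightarrow> emeasure \<mu> H = 0)}"

definition yao_yao_equipartition ::
    "'a::euclidean_space set \<Rightarrow> 'a measure \<Rightarrow> 'a set set \<Rightarrow> 'a \<Rightarrow> bool" where
  "yao_yao_equipartition E \<mu> P x \<longleftrightarrow> yao_yao E P x \<and>
     (\<forall>A\<in>P. A \<in> sets \<mu> \<and> measure \<mu> A = measure \<mu> E / 2 ^ nat (aff_dim E))"

definition yao_yao_center :: "'a::euclidean_space set \<Rightarrow> 'a measure \<Rightarrow> 'a \<Rightarrow> bool" where
  "yao_yao_center E \<mu> x \<longleftrightarrow> (\<exists>P. yao_yao_equipartition E \<mu> P x)"

end

theory Submission
  imports Defs
begin

text \<open>The proof is by induction on the dimension. Write \<open>E = F + \<real>e\<close>, project the measure along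
\<open>e\<close> and take a Yao-Yao equipartition of the base \<open>F\<close>. A Yao-Yao partition of \<open>E\<close> whose center
projects to the center of the base partition arises by cutting every prism \<open>A + \<real>e\<close> along a
graph that is affine on \<open>A\<close>; each binary split \<open>A + \<real>\<^sub>\<plusminus>v\<close> of the base contributes one free slope
\<open>w\<close>, by which \<open>v\<close> is replaced by \<open>v + w e\<close>, and both halves have to agree on the height \<open>b\<close> of the
center. The heights at which all prisms below a split can be bisected form a nonempty
compact interval, which moves in opposite directions in the two halves as \<open>w\<close> grows; so the
intermediate value theorem provides a slope for which the two intervals meet. For a symmetric measure it
suffices to partition one half-space: there the slope is chosen so that the height is that of
the center of symmetry, and the other half is the reflected partition.\<close>

section \<open>Bisecting the regions of a binary tree\<close>

text \<open>The obstacle is that medians are not unique: the measure may leave gaps, so the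
  bisecting height is a set-valued function of the slope. The intermediate value argument is
  therefore run on closed sets of slopes, of the kind "some height of one half lies below some
  height of the other"; they cover the line and meet by connectedness. To repeat this at the next
  split, the heights that a split admits must again form an interval moving monotonically with
  \<open>u\<close>, so the induction has to carry an order relation between sets of heights besides
  existence. Closedness rests on compactness of heights and slopes, which fails on regions of mass
  zero; over an equipartition of the base all regions have the same mass, so the only exception is
  the zero measure, which is treated apart. The tree depends on the base partition and not on the
  height function: entering a half replaces \<open>u\<close> by \<open>u - w * \<tau>\<close>, so
  the properties of a tree are stated for every measurable \<open>u\<close>.\<close>

text \<open>The function \<open>\<tau>\<close> at a split is the coordinate along the splitting vector \<open>v\<close>, and \<open>u\<close> in
\<open>bisects\<close> is the height along \<open>e\<close>. Tilting \<open>v\<close> to \<open>v + w e\<close> replaces \<open>u\<close> by \<open>u - w \<tau>\<close>.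
The weak inequalities in \<open>bisects\<close> make it closed under pointwise limits of \<open>u\<close> for every finite
measure.\<close>

datatype 'b split_tree = Region "'b set" | Split "'b \<Rightarrow> real" "'b split_tree" "'b split_tree"

primrec regions :: "'b split_tree \<Rightarrow> 'b set set" where
  "regions (Region A) = {A}"
| "regions (Split \<tau> T S) = regions T \<union> regions S"

primrec split_tree_on :: "'b measure \<Rightarrow> 'b split_tree \<Rightarrow> bool" where
  "split_tree_on M (Region A) \<longleftrightarrow> A \<in> sets M"
| "split_tree_on M (Split \<tau> T S) \<longleftrightarrow> \<tau> \<in> borel_measurable M
     \<and> (\<forall>\<omega>\<in>\<Union>(regions T). \<tau> \<omega> > 0) \<and> (\<forall>\<omega>\<in>\<Union>(regions S). \<tau> \<omega> < 0)
     \<and> split_tree_on M T \<and> split_tree_on M S"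

primrec bisects :: "'b measure \<Rightarrow> 'b split_tree \<Rightarrow> ('b \<Rightarrow> real) \<Rightarrow> real \<Rightarrow> bool" where
  "bisects M (Region A) u b \<longleftrightarrow>
     2 * measure M {\<omega>\<in>A. u \<omega> < b} \<le> measure M A \<and> 2 * measure M {\<omega>\<in>A. u \<omega> > b} \<le> measure M A"
| "bisects M (Split \<tau> T S) u b \<longleftrightarrow>
     (\<exists>w. bisects M T (\<lambda>\<omega>. u \<omega> - w * \<tau> \<omega>) b \<and> bisects M S (\<lambda>\<omega>. u \<omega> - w * \<tau> \<omega>) b)"

text \<open>Turning the heights upside down negates every slope in the tree. One-sided estimates are
  proved for upper bounds and transferred to lower bounds by this symmetry.\<close>

lemma bisects_uminus: "bisects M T u b \<Longrightarrow> bisects M T (\<lambda>\<omega>. - u \<omega>) (- b)"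
proof (induction T arbitrary: u)
  case (Split \<tau> T S)
  then obtain w where *: "bisects M T (\<lambda>\<omega>. u \<omega> - w * \<tau> \<omega>) b" "bisects M S (\<lambda>\<omega>. u \<omega> - w * \<tau> \<omega>) b"
    by auto
  have "bisects M T (\<lambda>\<omega>. - u \<omega> - (- w) * \<tau> \<omega>) (- b)" "bisects M S (\<lambda>\<omega>. - u \<omega> - (- w) * \<tau> \<omega>) (- b)"
    using Split.IH(1)[OF *(1)] Split.IH(2)[OF *(2)] by (simp_all add: algebra_simps)
  then show ?case unfolding bisects.simps by blast
qed auto

lemma bisects_add: "bisects M T u b \<Longrightarrow> bisects M T (\<lambda>\<omega>. u \<omega> + c) (b + c)"
proof (induction T arbitrary: u)
  case (Split \<tau> T S)
  then obtain w where *: "bisects M T (\<lambda>\<omega>. u \<omega> - w * \<tau> \<omega>) b" "bisects M S (\<lambda>\<omega>. u \<omega> - w * \<tau> \<omega>) b"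
    by auto
  have "bisects M T (\<lambda>\<omega>. u \<omega> + c - w * \<tau> \<omega>) (b + c)" "bisects M S (\<lambda>\<omega>. u \<omega> + c - w * \<tau> \<omega>) (b + c)"
    using Split.IH(1)[OF *(1)] Split.IH(2)[OF *(2)] by (simp_all add: algebra_simps)
  then show ?case unfolding bisects.simps by blast
qed auto

text \<open>Serves the degenerate case of zero mass, where compactness of the heights fails
  precisely because every height is a median of a null region.\<close>

lemma bisects_null: "(\<And>A. A \<in> regions T \<Longrightarrow> A \<in> null_sets M) \<Longrightarrow> bisects M T u b"
proof (induction T arbitrary: u)
  case (Region A)
  then have "A \<in> null_sets M" by auto
  then have "measure M B = 0" if "B \<subseteq> A" for B
    using that by (metis measure_eq_0_null_sets measure_notin_sets null_sets_subset)
  then show ?case by simp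
qed auto

lemma finite_regions: "finite (regions T)"
  by (induction T) auto

lemma regions_sets: "split_tree_on M T \<Longrightarrow> A \<in> regions T \<Longrightarrow> A \<in> sets M"
  by (induction T) auto

section \<open>Bounds and limits of bisecting heights and slopes\<close>

lemma unbounded_subseq:
  fixes b :: "nat \<Rightarrow> real"
  assumes "\<not> bdd_above (range b)"
  shows "\<exists>r :: nat \<Rightarrow> nat. strict_mono r \<and> (\<forall>k. b (r k) > real k)"
proof -
  have "\<exists>k>n. b k > B" for B n
  proof -
    \<comment> \<open>Exceeding also the values at all indices up to \<open>n\<close> forces the new
      index beyond \<open>n\<close>, which makes the chosen subsequence strictly increasing.\<close>
    have "\<exists>k. b k > Max (insert B (b ` {..n}))"
      using assms unfolding bdd_above_def by (metis (no_types) image_iff not_le)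
    then obtain k where k: "b k > Max (insert B (b ` {..n}))" by blast
    have "b k \<le> Max (insert B (b ` {..n}))" if "k \<le> n"
      using that by (intro Max_ge) auto
    with k have "k > n" by (meson leD leI)
    with k show ?thesis by auto
  qed
  then have "\<exists>r. \<forall>k. b (r k) > real k \<and> r k < r (Suc k)"
    by (intro dependent_nat_choice) auto
  then show ?thesis by (auto simp: strict_mono_Suc_iff)
qed

lemma bounded_range_realI:
  fixes b :: "'i \<Rightarrow> real"
  assumes "bdd_above (range b)" "bdd_above (range (\<lambda>k. - b k))"
  shows "bounded (range b)"
proof -
  obtain B C where "\<And>k. b k \<le> B" "\<And>k. - b k \<le> C"
    using assms by (auto simp: bdd_above_def)
  then have "\<bar>b k\<bar> \<le> max B C" for k
    by (smt (verit))
  then show ?thesis by (auto intro!: boundedI)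
qed

context finite_measure
begin

text \<open>Dominated convergence for indicators; finiteness of the measure makes the constant 1 an
  integrable bound. Only eventual agreement at each point is required, so the sets need not be
  monotone in \<open>k\<close>.\<close>

lemma measure_tendsto:
  assumes "\<And>k. B k \<in> sets M" "C \<in> sets M"
    and "\<And>\<omega>. \<omega> \<in> space M \<Longrightarrow> \<forall>\<^sub>F k in sequentially. \<omega> \<in> B k \<longleftrightarrow> \<omega> \<in> C"
  shows "(\<lambda>k. measure M (B k)) \<longlonglongrightarrow> measure M C"
proof -
  have "(\<lambda>k. integral\<^sup>L M (indicator (B k) :: _ \<Rightarrow> real)) \<longlonglongrightarrow> integral\<^sup>L M (indicator C)"
  proof (rule integral_dominated_convergence[where w = "\<lambda>_. 1"])
    show "AE \<omega> in M. (\<lambda>k. indicator (B k) \<omega> :: real) \<longlonglongrightarrow> indicator C \<omega>"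
    proof (rule AE_I2, rule tendsto_eventually)
      fix \<omega> assume "\<omega> \<in> space M"
      from assms(3)[OF this] show "\<forall>\<^sub>F k in sequentially. indicator (B k) \<omega> = (indicator C \<omega> :: real)"
        by eventually_elim (auto simp: indicator_def)
    qed
  qed (use assms in \<open>auto simp: indicator_def\<close>)
  then show ?thesis using assms sets.sets_into_space by (simp add: Int_absorb2)
qed

text \<open>A slope raises the height on at most one side of a split. On the side where
  \<open>w * \<tau>\<close> is nonnegative the tilted function lies below \<open>u\<close>, so the
  smallness of the sets \<open>u \<ge> c\<close> is inherited, and following such sides leads down
  to a single region. There \<open>b > c\<close> would cover the region by one set of less than half
  and one of at most half its mass.\<close>

lemma bisects_le:
  assumes "split_tree_on M T" "u \<in> borel_measurable M" "bisects M T u b"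
    and "\<And>A. A \<in> regions T \<Longrightarrow> 2 * measure M {\<omega>\<in>A. u \<omega> \<ge> c} < measure M A"
  shows "b \<le> c"
  using assms
proof (induction T arbitrary: u)
  case (Region A)
  show ?case
  proof (rule ccontr)
    assume "\<not> b \<le> c"
    have A: "A \<in> sets M" and [measurable]: "u \<in> borel_measurable M" using Region by auto
    have [measurable]: "Measurable.pred M (\<lambda>\<omega>. \<omega> \<in> A)" using A by simp
    have eq: "{\<omega>\<in>A. P \<omega>} = {\<omega>\<in>space M. \<omega> \<in> A \<and> P \<omega>}" for P
      using sets.sets_into_space[OF A] by auto
    have s: "{\<omega>\<in>A. u \<omega> \<ge> c} \<in> sets M" "{\<omega>\<in>A. u \<omega> < b} \<in> sets M" unfolding eq by measurable
    have "measure M A \<le> measure M ({\<omega>\<in>A. u \<omega> \<ge> c} \<union> {\<omega>\<in>A. u \<omega> < b})"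
      using s \<open>\<not> b \<le> c\<close> by (intro finite_measure_mono) auto
    also have "\<dots> \<le> measure M {\<omega>\<in>A. u \<omega> \<ge> c} + measure M {\<omega>\<in>A. u \<omega> < b}"
      using s by (rule measure_Un_le)
    finally show False using Region.prems by auto
  qed
next
  case (Split \<tau> T S)
  from Split.prems have [measurable]: "\<tau> \<in> borel_measurable M" "u \<in> borel_measurable M" by auto
  from Split.prems obtain w where w: "bisects M T (\<lambda>\<omega>. u \<omega> - w * \<tau> \<omega>) b" "bisects M S (\<lambda>\<omega>. u \<omega> - w * \<tau> \<omega>) b"
    by auto
  have *: "2 * measure M {\<omega>\<in>A. u \<omega> - w * \<tau> \<omega> \<ge> c} < measure M A"
    if A: "A \<in> sets M" and le: "2 * measure M {\<omega>\<in>A. u \<omega> \<ge> c} < measure M A"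
      and pos: "\<And>\<omega>. \<omega> \<in> A \<Longrightarrow> 0 \<le> w * \<tau> \<omega>" for A
  proof -
    have [measurable]: "Measurable.pred M (\<lambda>\<omega>. \<omega> \<in> A)" using A by simp
    have eq: "{\<omega>\<in>A. P \<omega>} = {\<omega>\<in>space M. \<omega> \<in> A \<and> P \<omega>}" for P
      using sets.sets_into_space[OF A] by auto
    have "{\<omega>\<in>A. u \<omega> \<ge> c} \<in> sets M" unfolding eq by measurable
    then have "measure M {\<omega>\<in>A. u \<omega> - w * \<tau> \<omega> \<ge> c} \<le> measure M {\<omega>\<in>A. u \<omega> \<ge> c}"
      using pos by (intro finite_measure_mono) force+
    with le show ?thesis by linarith
  qed
  show ?case
  proof (cases "0 \<le> w")
    case True
    show ?thesis
    proof (rule Split.IH(1)[OF _ _ w(1)])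
      fix A assume "A \<in> regions T"
      with Split.prems True show "2 * measure M {\<omega>\<in>A. u \<omega> - w * \<tau> \<omega> \<ge> c} < measure M A"
        by (intro *) (auto simp: regions_sets intro!: mult_nonneg_nonneg intro: less_imp_le)
    qed (use Split.prems in auto)
  next
    case False
    show ?thesis
    proof (rule Split.IH(2)[OF _ _ w(2)])
      fix A assume "A \<in> regions S"
      with Split.prems False show "2 * measure M {\<omega>\<in>A. u \<omega> - w * \<tau> \<omega> \<ge> c} < measure M A"
        by (intro *) (auto simp: regions_sets intro!: mult_nonpos_nonpos intro: less_imp_le)
    qed (use Split.prems in auto)
  qed
qed

text \<open>The mass of \<open>u k \<ge> c\<close> tends to zero in each of the finitely many
  regions, while half the mass of a region is a positive threshold; so \<open>bisects_le\<close>
  applies for all large \<open>k\<close>, uniformly over the bisecting heights of the same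
  \<open>k\<close>.\<close>

lemma bisects_eventually_le:
  assumes T: "split_tree_on M T" and pos: "\<And>A. A \<in> regions T \<Longrightarrow> 0 < measure M A"
    and u: "\<And>k. u k \<in> borel_measurable M"
    and lim: "\<And>\<omega>. \<omega> \<in> \<Union>(regions T) \<Longrightarrow> filterlim (\<lambda>k. u k \<omega>) at_bot sequentially"
  shows "\<forall>\<^sub>F k in sequentially. \<forall>b. bisects M T (u k) b \<longrightarrow> b \<le> c"
proof -
  have "\<forall>\<^sub>F k in sequentially. 2 * measure M {\<omega>\<in>A. u k \<omega> \<ge> c} < measure M A" if A: "A \<in> regions T" for A
  proof -
    have s: "A \<in> sets M" using T A by (rule regions_sets)
    have [measurable]: "Measurable.pred M (\<lambda>\<omega>. \<omega> \<in> A)" using s by simp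
    note u [measurable]
    have eq: "{\<omega>\<in>A. P \<omega>} = {\<omega>\<in>space M. \<omega> \<in> A \<and> P \<omega>}" for P
      using sets.sets_into_space[OF s] by auto
    have "(\<lambda>k. measure M {\<omega>\<in>A. u k \<omega> \<ge> c}) \<longlonglongrightarrow> measure M {}"
    proof (rule measure_tendsto)
      show "{\<omega>\<in>A. u k \<omega> \<ge> c} \<in> sets M" for k unfolding eq by measurable
      show "\<forall>\<^sub>F k in sequentially. \<omega> \<in> {\<omega>\<in>A. u k \<omega> \<ge> c} \<longleftrightarrow> \<omega> \<in> {}" for \<omega>
      proof (cases "\<omega> \<in> A")
        case True
        with lim[of \<omega>] A have "\<forall>\<^sub>F k in sequentially. u k \<omega> < c" by (auto simp: filterlim_at_bot_dense)
        then show ?thesis by eventually_elim auto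
      qed auto
    qed auto
    then have "(\<lambda>k. 2 * measure M {\<omega>\<in>A. u k \<omega> \<ge> c}) \<longlonglongrightarrow> 2 * 0" by (intro tendsto_mult) auto
    then show ?thesis using pos[OF A] by (intro order_tendstoD) auto
  qed
  then have "\<forall>\<^sub>F k in sequentially. \<forall>A\<in>regions T. 2 * measure M {\<omega>\<in>A. u k \<omega> \<ge> c} < measure M A"
    by (simp add: eventually_ball_finite finite_regions)
  then show ?thesis
    by eventually_elim (use bisects_le[OF T u] in blast)
qed

text \<open>Along a subsequence with \<open>b (r k) > k\<close>, lowering the heights by
  \<open>k\<close> leaves them positive; but the functions lowered by \<open>k\<close> tend to minus
  infinity, so their bisecting heights are eventually at most 0.\<close>

lemma bisects_bounded_above:
  assumes T: "split_tree_on M T" and pos: "\<And>A. A \<in> regions T \<Longrightarrow> 0 < measure M A"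
    and u: "\<And>k. u k \<in> borel_measurable M"
    and lim: "\<And>\<omega>. \<omega> \<in> \<Union>(regions T) \<Longrightarrow> (\<lambda>k. u k \<omega>) \<longlonglongrightarrow> v \<omega>"
    and b: "\<And>k. bisects M T (u k) (b k)"
  shows "bdd_above (range b)"
proof (rule ccontr)
  assume "\<not> bdd_above (range b)"
  then obtain r where "strict_mono (r :: nat \<Rightarrow> nat)" and r: "\<And>k. b (r k) > real k"
    using unbounded_subseq by metis
  have "filterlim (\<lambda>k. u (r k) \<omega> + (- real k)) at_bot sequentially" if "\<omega> \<in> \<Union>(regions T)" for \<omega>
    using lim[OF that, THEN LIMSEQ_subseq_LIMSEQ, OF \<open>strict_mono r\<close>] unfolding o_def
    by (rule filterlim_tendsto_add_at_bot_iff[THEN iffD2])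
       (simp add: filterlim_uminus_at_top[symmetric] filterlim_real_sequentially)
  then have "\<forall>\<^sub>F k in sequentially. \<forall>b. bisects M T (\<lambda>\<omega>. u (r k) \<omega> + (- real k)) b \<longrightarrow> b \<le> 0"
    by (intro bisects_eventually_le[OF T pos]) (auto intro!: borel_measurable_diff u)
  then obtain k where "\<forall>b. bisects M T (\<lambda>\<omega>. u (r k) \<omega> + (- real k)) b \<longrightarrow> b \<le> 0"
    by (auto simp: eventually_sequentially)
  with bisects_add[OF b[of "r k"], of "- real k"] r[of k] show False by fastforce
qed

lemma bisects_convergent_subseq:
  assumes T: "split_tree_on M T" and pos: "\<And>A. A \<in> regions T \<Longrightarrow> 0 < measure M A"
    and u: "\<And>k. u k \<in> borel_measurable M"
    and lim: "\<And>\<omega>. \<omega> \<in> \<Union>(regions T) \<Longrightarrow> (\<lambda>k. u k \<omega>) \<longlonglongrightarrow> v \<omega>"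
    and b: "\<And>k. bisects M T (u k) (b k)"
  obtains r l where "strict_mono r" "(b \<circ> r) \<longlonglongrightarrow> l"
proof -
  have "bdd_above (range b)" by (rule bisects_bounded_above[OF T pos u lim b])
  moreover have "bdd_above (range (\<lambda>k. - b k))"
    by (rule bisects_bounded_above[OF T pos, where u = "\<lambda>k \<omega>. - u k \<omega>" and v = "\<lambda>\<omega>. - v \<omega>"])
       (use u tendsto_minus[OF lim] bisects_uminus[OF b] in auto)
  ultimately have "bounded (range b)"
    by (rule bounded_range_realI)
  then show thesis using that bounded_imp_convergent_subsequence by blast
qed

text \<open>At a split the slopes of the approximants must be shown bounded before a limit slope can
  be extracted. If they were unbounded above, the functions on the positive side would tend to minus
  infinity along a subsequence and drag the heights below \<open>l - 1\<close>. Unboundedness below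
  is excluded in the same way on the negative side.\<close>

lemma bisects_closed:
  assumes "split_tree_on M T" "\<And>A. A \<in> regions T \<Longrightarrow> 0 < measure M A"
    and "\<And>k. u k \<in> borel_measurable M" "v \<in> borel_measurable M"
    and "\<And>\<omega>. \<omega> \<in> \<Union>(regions T) \<Longrightarrow> (\<lambda>k. u k \<omega>) \<longlonglongrightarrow> v \<omega>"
    and "\<And>k. bisects M T (u k) (b k)" and "b \<longlonglongrightarrow> l"
  shows "bisects M T v l"
  using assms
proof (induction T arbitrary: u v b)
  case (Region A)
  have A: "A \<in> sets M" and u[measurable]: "u k \<in> borel_measurable M" "v \<in> borel_measurable M" for k
    using Region by auto
  have [measurable]: "Measurable.pred M (\<lambda>\<omega>. \<omega> \<in> A)" using A by simp
  have eq: "{\<omega>\<in>A. P \<omega>} = {\<omega>\<in>space M. \<omega> \<in> A \<and> P \<omega>}" for P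
    using sets.sets_into_space[OF A] by auto
  have "2 * measure M {\<omega>\<in>A. v \<omega> < l} \<le> measure M A"
    if [measurable]: "\<And>k. u k \<in> borel_measurable M" "v \<in> borel_measurable M"
      and lim: "\<And>\<omega>. \<omega> \<in> A \<Longrightarrow> (\<lambda>k. u k \<omega>) \<longlonglongrightarrow> v \<omega>" "b \<longlonglongrightarrow> l"
      and b: "\<And>k. 2 * measure M {\<omega>\<in>A. u k \<omega> < b k} \<le> measure M A" for u :: "nat \<Rightarrow> 'a \<Rightarrow> real" and v b l
  proof -
    \<comment> \<open>At points with \<open>v \<omega> = l\<close>, membership in
      \<open>u k < b k\<close> may oscillate forever. Intersecting with \<open>v < l\<close> removes
      them, and the upper bound on the mass survives on the smaller set.\<close>
    have "(\<lambda>k. measure M {\<omega>\<in>A. u k \<omega> < b k \<and> v \<omega> < l}) \<longlonglongrightarrow> measure M {\<omega>\<in>A. v \<omega> < l}"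
    proof (rule measure_tendsto)
      show "\<forall>\<^sub>F k in sequentially. \<omega> \<in> {\<omega>\<in>A. u k \<omega> < b k \<and> v \<omega> < l} \<longleftrightarrow> \<omega> \<in> {\<omega>\<in>A. v \<omega> < l}" for \<omega>
      proof (cases "\<omega> \<in> A \<and> v \<omega> < l")
        case True
        then obtain m where m: "v \<omega> < m" "m < l" using dense by blast
        with True lim have "\<forall>\<^sub>F k in sequentially. u k \<omega> < m" "\<forall>\<^sub>F k in sequentially. m < b k"
          by (auto intro: order_tendstoD(1)[OF lim(2)] order_tendstoD(2)[OF lim(1)])
        then show ?thesis by eventually_elim (use True in auto)
      qed auto
    qed (simp_all add: eq)
    then have "(\<lambda>k. 2 * measure M {\<omega>\<in>A. u k \<omega> < b k \<and> v \<omega> < l}) \<longlonglongrightarrow> 2 * measure M {\<omega>\<in>A. v \<omega> < l}"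
      by (intro tendsto_mult) auto
    then show ?thesis
    proof (rule LIMSEQ_le_const2)
      have "{\<omega>\<in>A. u k \<omega> < b k} \<in> sets M" for k unfolding eq by measurable
      then have "measure M {\<omega>\<in>A. u k \<omega> < b k \<and> v \<omega> < l} \<le> measure M {\<omega>\<in>A. u k \<omega> < b k}" for k
        by (intro finite_measure_mono) auto
      with b have "2 * measure M {\<omega>\<in>A. u k \<omega> < b k \<and> v \<omega> < l} \<le> measure M A" for k
        by (meson mult_left_mono order_trans zero_le_numeral)
      then show "\<exists>K. \<forall>k\<ge>K. 2 * measure M {\<omega>\<in>A. u k \<omega> < b k \<and> v \<omega> < l} \<le> measure M A"
        by blast
    qed
  qed
  note half = this
  have "2 * measure M {\<omega>\<in>A. v \<omega> < l} \<le> measure M A"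
    by (rule half[of u v b l]) (use Region.prems in simp_all)
  moreover have "2 * measure M {\<omega>\<in>A. - v \<omega> < - l} \<le> measure M A"
    by (rule half[of "\<lambda>k \<omega>. - u k \<omega>" "\<lambda>\<omega>. - v \<omega>" "\<lambda>k. - b k" "- l"])
       (use Region.prems in \<open>simp_all add: tendsto_minus\<close>)
  ultimately show ?case by simp
next
  case (Split \<tau> T S)
  have [measurable]: "\<tau> \<in> borel_measurable M" "\<And>k. u k \<in> borel_measurable M" "v \<in> borel_measurable M"
    using Split.prems by auto
  obtain w where w: "\<And>k. bisects M T (\<lambda>\<omega>. u k \<omega> - w k * \<tau> \<omega>) (b k)"
      "\<And>k. bisects M S (\<lambda>\<omega>. u k \<omega> - w k * \<tau> \<omega>) (b k)"
    using Split.prems(6) by simp metis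
  \<comment> \<open>Stated for any tree with positive coordinate, so that it also serves for
    \<open>S\<close> with \<open>- \<tau>\<close> and \<open>- w\<close>, which leave the product
    \<open>w * \<tau>\<close> unchanged.\<close>
  have bdd: "bdd_above (range w)"
    if T: "split_tree_on M T" "\<And>A. A \<in> regions T \<Longrightarrow> 0 < measure M A"
      and lim: "\<And>\<omega>. \<omega> \<in> \<Union>(regions T) \<Longrightarrow> (\<lambda>k. u k \<omega>) \<longlonglongrightarrow> v \<omega>"
      and pos: "\<And>\<omega>. \<omega> \<in> \<Union>(regions T) \<Longrightarrow> \<tau> \<omega> > 0" and [measurable]: "\<tau> \<in> borel_measurable M"
      and w: "\<And>k. bisects M T (\<lambda>\<omega>. u k \<omega> - w k * \<tau> \<omega>) (b k)" for T \<tau> w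
  proof (rule ccontr)
    assume "\<not> bdd_above (range w)"
    then obtain r where r: "strict_mono (r :: nat \<Rightarrow> nat)" "\<And>k. w (r k) > real k"
      using unbounded_subseq by metis
    from \<open>b \<longlonglongrightarrow> l\<close> have "(\<lambda>k. b (r k)) \<longlonglongrightarrow> l" using r(1) by (rule LIMSEQ_subseq_LIMSEQ[unfolded o_def])
    then have "\<forall>\<^sub>F k in sequentially. b (r k) > l - 1" by (rule order_tendstoD) simp
    moreover have "\<forall>\<^sub>F k in sequentially. \<forall>b. bisects M T (\<lambda>\<omega>. u (r k) \<omega> - w (r k) * \<tau> \<omega>) b \<longrightarrow> b \<le> l - 1"
    proof (rule bisects_eventually_le[OF T])
      fix \<omega> assume \<omega>: "\<omega> \<in> \<Union>(regions T)"
      have "filterlim (\<lambda>k. w (r k)) at_top sequentially"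
        by (rule filterlim_at_top_mono[OF filterlim_real_sequentially]) (use r(2) less_imp_le in \<open>simp add: less_imp_le\<close>)
      then have "filterlim (\<lambda>k. - (w (r k) * \<tau> \<omega>)) at_bot sequentially"
        using pos[OF \<omega>] unfolding filterlim_uminus_at_bot
        by (simp add: filterlim_at_top_mult_tendsto_pos[OF tendsto_const])
      from filterlim_tendsto_add_at_bot_iff[OF LIMSEQ_subseq_LIMSEQ[OF lim[OF \<omega>] r(1), unfolded o_def], THEN iffD2, OF this]
      show "filterlim (\<lambda>k. u (r k) \<omega> - w (r k) * \<tau> \<omega>) at_bot sequentially" by simp
    qed measurable
    ultimately have "\<forall>\<^sub>F k in sequentially. False"
      by eventually_elim (use w in force)
    then show False by simp
  qed
  have "bdd_above (range w)"
    by (rule bdd[OF _ _ _ _ _ w(1)]) (use Split.prems in auto)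
  moreover have "bdd_above (range (\<lambda>k. - w k))"
    by (rule bdd[where \<tau> = "\<lambda>\<omega>. - \<tau> \<omega>", of S]) (use Split.prems w in auto)
  ultimately have "bounded (range w)"
    by (rule bounded_range_realI)
  then obtain w0 r where r: "strict_mono r" "(w \<circ> r) \<longlonglongrightarrow> w0"
    using bounded_imp_convergent_subsequence by blast
  have lim: "(\<lambda>k. u (r k) \<omega> - w (r k) * \<tau> \<omega>) \<longlonglongrightarrow> v \<omega> - w0 * \<tau> \<omega>" if "\<omega> \<in> \<Union>(regions (Split \<tau> T S))" for \<omega>
  proof -
    have "(\<lambda>k. u (r k) \<omega>) \<longlonglongrightarrow> v \<omega>"
      using Split.prems(5)[OF that] r(1) by (rule LIMSEQ_subseq_LIMSEQ[unfolded o_def])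
    then show ?thesis using r(2) unfolding o_def by (intro tendsto_diff tendsto_mult_right)
  qed
  have bl: "(\<lambda>k. b (r k)) \<longlonglongrightarrow> l" using \<open>b \<longlonglongrightarrow> l\<close> r(1) by (rule LIMSEQ_subseq_LIMSEQ[unfolded o_def])
  have "bisects M T (\<lambda>\<omega>. v \<omega> - w0 * \<tau> \<omega>) l"
    by (rule Split.IH(1)[OF _ _ _ _ _ w(1) bl]) (use Split.prems lim in auto)
  moreover have "bisects M S (\<lambda>\<omega>. v \<omega> - w0 * \<tau> \<omega>) l"
    by (rule Split.IH(2)[OF _ _ _ _ _ w(2) bl]) (use Split.prems lim in auto)
  ultimately show ?case by auto
qed

end

section \<open>Order structure of the sets of bisecting heights\<close>

lemma bisects_uminus_iff: "bisects M T (\<lambda>\<omega>. - u \<omega>) (- b) \<longleftrightarrow> bisects M T u b"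
  using bisects_uminus[of M T u b] bisects_uminus[of M T "\<lambda>\<omega>. - u \<omega>" "- b"] by auto

text \<open>Lets an argument about two slopes assume their order: exchanging the halves negates
  \<open>\<tau>\<close> and with it the slopes.\<close>

lemma bisects_Split_swap:
  "bisects M (Split \<tau> T S) u b \<longleftrightarrow> bisects M (Split (\<lambda>\<omega>. - \<tau> \<omega>) S T) u b"
proof -
  have "(\<exists>w. P w) \<longleftrightarrow> (\<exists>w. P (- w))" for P :: "real \<Rightarrow> bool"
    by (metis minus_minus)
  from this[of "\<lambda>w. bisects M T (\<lambda>\<omega>. u \<omega> - w * \<tau> \<omega>) b \<and> bisects M S (\<lambda>\<omega>. u \<omega> - w * \<tau> \<omega>) b"]
  show ?thesis by (auto simp: conj_commute)
qed

text \<open>Quantified over all measurable \<open>u\<close>, because every split above the tree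
  tilts \<open>u\<close> by an arbitrary multiple of its own coordinate.\<close>

definition interval_bisected :: "'b measure \<Rightarrow> 'b split_tree \<Rightarrow> bool" where
  "interval_bisected M T \<longleftrightarrow> (\<forall>u\<in>borel_measurable M. (\<exists>b. bisects M T u b) \<and>
     (\<forall>b b' c. bisects M T u b \<longrightarrow> bisects M T u b' \<longrightarrow> b \<le> c \<longrightarrow> c \<le> b' \<longrightarrow> bisects M T u c))"

text \<open>Together with its negated form, this is the strong set order on the sets of bisecting heights;
mere monotonicity of their endpoints would not survive the passage to a split.\<close>

definition monotonically_bisected :: "'b measure \<Rightarrow> 'b split_tree \<Rightarrow> bool" where
  "monotonically_bisected M T \<longleftrightarrow> (\<forall>u\<in>borel_measurable M. \<forall>v\<in>borel_measurable M. \<forall>b b'.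
     (\<forall>\<omega>\<in>\<Union>(regions T). u \<omega> \<le> v \<omega>) \<longrightarrow> bisects M T u b \<longrightarrow> bisects M T v b' \<longrightarrow> b' \<le> b \<longrightarrow>
     bisects M T u b')"

lemma interval_bisectedD:
  assumes "interval_bisected M T" "u \<in> borel_measurable M"
  shows "\<exists>b. bisects M T u b"
    and "bisects M T u b \<Longrightarrow> bisects M T u b' \<Longrightarrow> b \<le> c \<Longrightarrow> c \<le> b' \<Longrightarrow> bisects M T u c"
  using assms unfolding interval_bisected_def by blast+

lemma monotonically_bisectedD1:
  assumes "monotonically_bisected M T" "u \<in> borel_measurable M" "v \<in> borel_measurable M"
    and "\<And>\<omega>. \<omega> \<in> \<Union>(regions T) \<Longrightarrow> u \<omega> \<le> v \<omega>" "bisects M T u b" "bisects M T v b'" "b' \<le> b"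
  shows "bisects M T u b'"
  using assms unfolding monotonically_bisected_def by blast

lemma monotonically_bisectedD2:
  assumes "monotonically_bisected M T" "u \<in> borel_measurable M" "v \<in> borel_measurable M"
    and "\<And>\<omega>. \<omega> \<in> \<Union>(regions T) \<Longrightarrow> u \<omega> \<le> v \<omega>" "bisects M T u b" "bisects M T v b'" "b' \<le> b"
  shows "bisects M T v b"
proof -
  have "bisects M T (\<lambda>\<omega>. - v \<omega>) (- b)"
    by (rule monotonically_bisectedD1[OF assms(1), of _ "\<lambda>\<omega>. - u \<omega>" "- b'"])
       (use assms in \<open>auto simp: bisects_uminus_iff\<close>)
  then show ?thesis by (simp add: bisects_uminus_iff)
qed

text \<open>Take any height \<open>d\<close> bisecting \<open>v\<close>. If it is at least
  \<open>b\<close>, compare \<open>v\<close> with \<open>x\<close>, otherwise \<open>u\<close> with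
  \<open>v\<close>; either way the strong set order hands \<open>b\<close> over to \<open>v\<close>.
  On one side of a split this means that a height available at two slopes is available at all slopes
  between them.\<close>

lemma bisects_between:
  assumes "interval_bisected M T" "monotonically_bisected M T"
    and "u \<in> borel_measurable M" "v \<in> borel_measurable M" "x \<in> borel_measurable M"
    and uv: "\<And>\<omega>. \<omega> \<in> \<Union>(regions T) \<Longrightarrow> u \<omega> \<le> v \<omega>"
    and vx: "\<And>\<omega>. \<omega> \<in> \<Union>(regions T) \<Longrightarrow> v \<omega> \<le> x \<omega>"
    and b: "bisects M T u b" "bisects M T x b"
  shows "bisects M T v b"
proof -
  obtain d where d: "bisects M T v d" using interval_bisectedD(1)[OF assms(1,4)] by blast
  show ?thesis
  proof (cases "b \<le> d")
    case True
    from monotonically_bisectedD1[OF assms(2,4,5) vx d b(2) True] show ?thesis .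
  next
    case False
    then have "d \<le> b" by simp
    from monotonically_bisectedD2[OF assms(2,3,4) uv b(1) d this] show ?thesis .
  qed
qed

section \<open>Closed sets of slopes and the intermediate value argument\<close>

context finite_measure
begin

text \<open>A substitute for comparing endpoints of two intervals that depend on the slope: only the
  existence of comparable heights is recorded, and this passes to limits. The heights of the two
  trees are made convergent one after the other, hence the nested subsequences.\<close>

lemma closed_slopes_le:
  assumes T: "split_tree_on M T" and pos: "\<And>A. A \<in> regions T \<Longrightarrow> 0 < measure M A"
    and S: "split_tree_on M S" and posS: "\<And>A. A \<in> regions S \<Longrightarrow> 0 < measure M A"
    and [measurable]: "u \<in> borel_measurable M" "\<tau> \<in> borel_measurable M" "v \<in> borel_measurable M" "\<sigma> \<in> borel_measurable M"
  shows "closed {w. \<exists>b d. bisects M T (\<lambda>\<omega>. u \<omega> - w * \<tau> \<omega>) b \<and> bisects M S (\<lambda>\<omega>. v \<omega> - w * \<sigma> \<omega>) d \<and> b \<le> d}"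
  unfolding closed_sequential_limits
proof safe
  fix w :: "nat \<Rightarrow> real" and w0
  assume *: "\<forall>n. w n \<in> {w. \<exists>b d. bisects M T (\<lambda>\<omega>. u \<omega> - w * \<tau> \<omega>) b \<and> bisects M S (\<lambda>\<omega>. v \<omega> - w * \<sigma> \<omega>) d \<and> b \<le> d}"
    and lim: "w \<longlonglongrightarrow> w0"
  then obtain b d where b: "\<And>n. bisects M T (\<lambda>\<omega>. u \<omega> - w n * \<tau> \<omega>) (b n)"
    and d: "\<And>n. bisects M S (\<lambda>\<omega>. v \<omega> - w n * \<sigma> \<omega>) (d n)" and bd: "\<And>n. b n \<le> d n"
    by simp metis
  have ul: "(\<lambda>n. u \<omega> - w n * \<tau> \<omega>) \<longlonglongrightarrow> u \<omega> - w0 * \<tau> \<omega>" for \<omega>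
    by (intro tendsto_intros lim)
  have vl: "(\<lambda>n. v \<omega> - w n * \<sigma> \<omega>) \<longlonglongrightarrow> v \<omega> - w0 * \<sigma> \<omega>" for \<omega>
    by (intro tendsto_intros lim)
  obtain r l where r: "strict_mono r" "(b \<circ> r) \<longlonglongrightarrow> l"
    by (rule bisects_convergent_subseq[OF T pos _ ul b]) auto
  have vl': "(\<lambda>n. v \<omega> - w (r n) * \<sigma> \<omega>) \<longlonglongrightarrow> v \<omega> - w0 * \<sigma> \<omega>" for \<omega>
    using vl r(1) by (rule LIMSEQ_subseq_LIMSEQ[unfolded o_def])
  obtain q m where q: "strict_mono q" "((\<lambda>n. d (r n)) \<circ> q) \<longlonglongrightarrow> m"
    by (rule bisects_convergent_subseq[OF S posS _ vl' d]) auto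
  have s: "strict_mono (r \<circ> q)" using r(1) q(1) by (rule strict_mono_o)
  have bl: "(\<lambda>n. b ((r \<circ> q) n)) \<longlonglongrightarrow> l"
    using LIMSEQ_subseq_LIMSEQ[OF r(2) q(1)] by (simp add: o_def)
  have dl: "(\<lambda>n. d ((r \<circ> q) n)) \<longlonglongrightarrow> m"
    using q(2) by (simp add: o_def)
  have "bisects M T (\<lambda>\<omega>. u \<omega> - w0 * \<tau> \<omega>) l"
    by (rule bisects_closed[OF T pos _ _ LIMSEQ_subseq_LIMSEQ[OF ul s, unfolded o_def] b bl[unfolded o_def]]) auto
  moreover have "bisects M S (\<lambda>\<omega>. v \<omega> - w0 * \<sigma> \<omega>) m"
    by (rule bisects_closed[OF S posS _ _ LIMSEQ_subseq_LIMSEQ[OF vl s, unfolded o_def] d dl[unfolded o_def]]) auto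
  moreover have "l \<le> m" using bl dl bd by (blast intro: LIMSEQ_le)
  ultimately show "\<exists>b d. bisects M T (\<lambda>\<omega>. u \<omega> - w0 * \<tau> \<omega>) b \<and> bisects M S (\<lambda>\<omega>. v \<omega> - w0 * \<sigma> \<omega>) d \<and> b \<le> d"
    by blast
qed

lemma closed_slopes_le_const:
  assumes T: "split_tree_on M T" and pos: "\<And>A. A \<in> regions T \<Longrightarrow> 0 < measure M A"
    and [measurable]: "u \<in> borel_measurable M" "\<tau> \<in> borel_measurable M"
  shows "closed {w. \<exists>b\<le>c. bisects M T (\<lambda>\<omega>. u \<omega> - w * \<tau> \<omega>) b}"
  unfolding closed_sequential_limits
proof safe
  fix w :: "nat \<Rightarrow> real" and w0
  assume *: "\<forall>n. w n \<in> {w. \<exists>b\<le>c. bisects M T (\<lambda>\<omega>. u \<omega> - w * \<tau> \<omega>) b}" and lim: "w \<longlonglongrightarrow> w0"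
  then obtain b where b: "\<And>n. bisects M T (\<lambda>\<omega>. u \<omega> - w n * \<tau> \<omega>) (b n)" and bc: "\<And>n. b n \<le> c"
    by simp metis
  have ul: "(\<lambda>n. u \<omega> - w n * \<tau> \<omega>) \<longlonglongrightarrow> u \<omega> - w0 * \<tau> \<omega>" for \<omega>
    by (intro tendsto_intros lim)
  obtain r l where r: "strict_mono r" "(b \<circ> r) \<longlonglongrightarrow> l"
    by (rule bisects_convergent_subseq[OF T pos _ ul b]) auto
  have "bisects M T (\<lambda>\<omega>. u \<omega> - w0 * \<tau> \<omega>) l"
    by (rule bisects_closed[OF T pos _ _ LIMSEQ_subseq_LIMSEQ[OF ul r(1), unfolded o_def] b r(2)[unfolded o_def]]) auto
  moreover have "l \<le> c" using r(2) bc by (intro LIMSEQ_le_const2[OF r(2)]) (auto simp: o_def)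
  ultimately show "\<exists>b\<le>c. bisects M T (\<lambda>\<omega>. u \<omega> - w0 * \<tau> \<omega>) b" by blast
qed

text \<open>An intermediate value theorem for a set-valued function. The slopes with a height at
  most \<open>c\<close> and those with a height at least \<open>c\<close> are closed and cover the
  line, so they meet on the segment; at a common slope the interval property yields \<open>c\<close>
  itself. The two slopes may come in either order.\<close>

lemma bisects_ivt:
  assumes T: "split_tree_on M T" and pos: "\<And>A. A \<in> regions T \<Longrightarrow> 0 < measure M A"
    and int: "interval_bisected M T"
    and [measurable]: "u \<in> borel_measurable M" "\<tau> \<in> borel_measurable M"
    and b: "bisects M T (\<lambda>\<omega>. u \<omega> - w1 * \<tau> \<omega>) b1" "bisects M T (\<lambda>\<omega>. u \<omega> - w2 * \<tau> \<omega>) b2"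
    and c: "b1 \<le> c" "c \<le> b2"
  shows "\<exists>w\<in>closed_segment w1 w2. bisects M T (\<lambda>\<omega>. u \<omega> - w * \<tau> \<omega>) c"
proof -
  define A where "A = {w. \<exists>b\<le>c. bisects M T (\<lambda>\<omega>. u \<omega> - w * \<tau> \<omega>) b}"
  define B where "B = {w. \<exists>b\<ge>c. bisects M T (\<lambda>\<omega>. u \<omega> - w * \<tau> \<omega>) b}"
  \<comment> \<open>Rewritten as a set of the first kind for \<open>- u\<close>,
    \<open>- \<tau>\<close> and \<open>- c\<close>, so that one closedness lemma serves
    both.\<close>
  have "B = {w. \<exists>b\<le>- c. bisects M T (\<lambda>\<omega>. - u \<omega> - w * (- \<tau> \<omega>)) b}"
  proof -
    have "(\<exists>b\<ge>c. P b) \<longleftrightarrow> (\<exists>b\<le>- c. P (- b))" for P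
      by (metis minus_minus neg_le_iff_le)
    moreover have "bisects M T (\<lambda>\<omega>. u \<omega> - w * \<tau> \<omega>) (- b) \<longleftrightarrow> bisects M T (\<lambda>\<omega>. - u \<omega> - w * (- \<tau> \<omega>)) b" for w b
      using bisects_uminus_iff[of M T "\<lambda>\<omega>. u \<omega> - w * \<tau> \<omega>" "- b"] by (simp add: algebra_simps)
    ultimately show ?thesis by (simp add: B_def)
  qed
  moreover have "closed {w. \<exists>b\<le>- c. bisects M T (\<lambda>\<omega>. - u \<omega> - w * (- \<tau> \<omega>)) b}"
    by (rule closed_slopes_le_const[OF T pos]) auto
  ultimately have "closed B" by simp
  moreover have "closed A" unfolding A_def by (rule closed_slopes_le_const[OF T pos]) auto
  moreover have "w \<in> A \<union> B" for w
  proof -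
    obtain d where "bisects M T (\<lambda>\<omega>. u \<omega> - w * \<tau> \<omega>) d"
      using interval_bisectedD(1)[OF int, of "\<lambda>\<omega>. u \<omega> - w * \<tau> \<omega>"] by auto
    then show ?thesis unfolding A_def B_def by (cases "d \<le> c") auto
  qed
  moreover have "w1 \<in> A" "w2 \<in> B" using b c by (auto simp: A_def B_def)
  moreover have "connected (closed_segment w1 w2)" by (rule connected_segment)
  ultimately have "A \<inter> B \<inter> closed_segment w1 w2 \<noteq> {}"
    unfolding connected_closed by (metis Int_iff UnCI empty_iff ends_in_segment(1) ends_in_segment(2) subsetI)
  then obtain w d e where "w \<in> closed_segment w1 w2" and de: "bisects M T (\<lambda>\<omega>. u \<omega> - w * \<tau> \<omega>) d" "d \<le> c"
    "bisects M T (\<lambda>\<omega>. u \<omega> - w * \<tau> \<omega>) e" "c \<le> e"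
    unfolding A_def B_def by blast
  moreover have "bisects M T (\<lambda>\<omega>. u \<omega> - w * \<tau> \<omega>) c"
    by (rule interval_bisectedD(2)[OF int _ de(1,3,2,4)]) auto
  ultimately show ?thesis by blast
qed

lemma eventually_slope_le:
  assumes T: "split_tree_on M T" and pos: "\<And>A. A \<in> regions T \<Longrightarrow> 0 < measure M A"
    and [measurable]: "u \<in> borel_measurable M" "\<tau> \<in> borel_measurable M"
    and \<tau>: "\<And>\<omega>. \<omega> \<in> \<Union>(regions T) \<Longrightarrow> \<tau> \<omega> > 0"
  shows "\<forall>\<^sub>F k in sequentially. \<forall>b. bisects M T (\<lambda>\<omega>. u \<omega> - real k * \<tau> \<omega>) b \<longrightarrow> b \<le> c"
proof (rule bisects_eventually_le[OF T pos])
  fix \<omega> assume \<omega>: "\<omega> \<in> \<Union>(regions T)"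
  have "filterlim (\<lambda>k. - (real k * \<tau> \<omega>)) at_bot sequentially"
    using \<tau>[OF \<omega>] unfolding filterlim_uminus_at_bot
    by (simp add: filterlim_at_top_mult_tendsto_pos[OF tendsto_const] filterlim_real_sequentially)
  from filterlim_tendsto_add_at_bot_iff[OF tendsto_const, THEN iffD2, OF this]
  show "filterlim (\<lambda>k. u \<omega> - real k * \<tau> \<omega>) at_bot sequentially" by simp
qed measurable

lemma eventually_slope_ge:
  assumes T: "split_tree_on M T" and pos: "\<And>A. A \<in> regions T \<Longrightarrow> 0 < measure M A"
    and [measurable]: "u \<in> borel_measurable M" "\<tau> \<in> borel_measurable M"
    and \<tau>: "\<And>\<omega>. \<omega> \<in> \<Union>(regions T) \<Longrightarrow> \<tau> \<omega> < 0"
  shows "\<forall>\<^sub>F k in sequentially. \<forall>b. bisects M T (\<lambda>\<omega>. u \<omega> - real k * \<tau> \<omega>) b \<longrightarrow> c \<le> b"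
proof -
  have "\<forall>\<^sub>F k in sequentially. \<forall>b. bisects M T (\<lambda>\<omega>. - u \<omega> - real k * (- \<tau> \<omega>)) b \<longrightarrow> b \<le> - c"
    using \<tau> by (intro eventually_slope_le[OF T pos]) auto
  then show ?thesis
  proof eventually_elim
    case (elim k)
    show ?case
    proof (intro allI impI)
      fix b assume "bisects M T (\<lambda>\<omega>. u \<omega> - real k * \<tau> \<omega>) b"
      from bisects_uminus[OF this] elim[rule_format, of "- b"] show "c \<le> b" by (simp add: algebra_simps)
    qed
  qed
qed

text \<open>The halves respond to the slope in opposite directions: for steep positive slopes the
  heights of \<open>T\<close> lie below those of \<open>S\<close>, for steep negative ones above. So
  the closed sets of slopes with \<open>T\<close> below \<open>S\<close> and with \<open>S\<close>
  below \<open>T\<close> are both nonempty; they cover the line and therefore meet, and at a common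
  slope the two intervals of heights overlap.\<close>

lemma bisects_Split_ex:
  assumes TS: "split_tree_on M (Split \<tau> T S)" and pos: "\<And>A. A \<in> regions (Split \<tau> T S) \<Longrightarrow> 0 < measure M A"
    and T: "interval_bisected M T" and S: "interval_bisected M S"
    and [measurable]: "u \<in> borel_measurable M"
  shows "\<exists>b. bisects M (Split \<tau> T S) u b"
proof -
  have [measurable]: "\<tau> \<in> borel_measurable M" using TS by simp
  have trees: "split_tree_on M T" "split_tree_on M S" using TS by auto
  have posT: "0 < measure M A" if "A \<in> regions T" for A using pos that by auto
  have posS: "0 < measure M A" if "A \<in> regions S" for A using pos that by auto
  let ?u = "\<lambda>w \<omega>. u \<omega> - w * \<tau> \<omega>"
  define A where "A = {w. \<exists>b d. bisects M T (?u w) b \<and> bisects M S (?u w) d \<and> b \<le> d}"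
  define B where "B = {w. \<exists>b d. bisects M S (?u w) b \<and> bisects M T (?u w) d \<and> b \<le> d}"
  have meas: "?u w \<in> borel_measurable M" for w by measurable
  have ex: "\<exists>b. bisects M T (?u w) b" "\<exists>b. bisects M S (?u w) b" for w
    using interval_bisectedD(1)[OF T meas] interval_bisectedD(1)[OF S meas] by auto
  have "closed A" "closed B" unfolding A_def B_def
    by (rule closed_slopes_le trees posT posS; measurable)+
  moreover have "w \<in> A \<union> B" for w
    using ex[of w] unfolding A_def B_def by (simp, metis linear)
  moreover have "A \<noteq> {}"
  proof -
    have "\<forall>\<^sub>F k in sequentially. (\<forall>b. bisects M T (?u (real k)) b \<longrightarrow> b \<le> 0) \<and> (\<forall>b. bisects M S (?u (real k)) b \<longrightarrow> 0 \<le> b)"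
      using TS by (intro eventually_conj eventually_slope_le eventually_slope_ge trees posT posS) auto
    then obtain k where "\<forall>b. bisects M T (?u (real k)) b \<longrightarrow> b \<le> 0" "\<forall>b. bisects M S (?u (real k)) b \<longrightarrow> 0 \<le> b"
      by (auto simp: eventually_sequentially)
    moreover obtain b d where "bisects M T (?u (real k)) b" "bisects M S (?u (real k)) d"
      using ex by blast
    ultimately have "real k \<in> A" unfolding A_def by (blast intro: order_trans)
    then show ?thesis by blast
  qed
  moreover have "B \<noteq> {}"
  proof -
    have "\<forall>\<^sub>F k in sequentially. (\<forall>b. bisects M S (\<lambda>\<omega>. u \<omega> - real k * (- \<tau> \<omega>)) b \<longrightarrow> b \<le> 0)
        \<and> (\<forall>b. bisects M T (\<lambda>\<omega>. u \<omega> - real k * (- \<tau> \<omega>)) b \<longrightarrow> 0 \<le> b)"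
      using TS by (intro eventually_conj eventually_slope_le eventually_slope_ge trees posT posS) auto
    then obtain k where "\<forall>b. bisects M S (?u (- real k)) b \<longrightarrow> b \<le> 0" "\<forall>b. bisects M T (?u (- real k)) b \<longrightarrow> 0 \<le> b"
      by (auto simp: eventually_sequentially)
    moreover obtain b d where "bisects M S (?u (- real k)) b" "bisects M T (?u (- real k)) d"
      using ex by blast
    ultimately have "- real k \<in> B" unfolding B_def by (blast intro: order_trans)
    then show ?thesis by blast
  qed
  ultimately have "A \<inter> B \<noteq> {}"
    using connected_UNIV[where 'a = real] unfolding connected_closed
    by (metis Int_UNIV_right subsetI)
  then obtain w c d c' d' where w: "bisects M T (?u w) c" "bisects M S (?u w) d" "c \<le> d"
     "bisects M S (?u w) d'" "bisects M T (?u w) c'" "d' \<le> c'"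
    unfolding A_def B_def by blast
  \<comment> \<open>Since \<open>c \<le> d\<close> and \<open>d' \<le> c'\<close>, the larger of the
    two lower ends lies in both intervals.\<close>
  define b where "b = max (min c c') (min d d')"
  have "bisects M T (?u w) (min c c')" "bisects M T (?u w) (max c c')"
    "bisects M S (?u w) (min d d')" "bisects M S (?u w) (max d d')"
    using w by (auto simp: min_def max_def)
  moreover have "min c c' \<le> b" "b \<le> max c c'" "min d d' \<le> b" "b \<le> max d d'"
    using w by (auto simp: b_def)
  ultimately have "bisects M T (?u w) b" "bisects M S (?u w) b"
    using interval_bisectedD(2)[OF T meas] interval_bisectedD(2)[OF S meas] by blast+
  then show ?thesis by auto
qed

text \<open>From \<open>w\<close> to \<open>w'\<close> the tilted functions decrease on
  \<open>T\<close> although the height grows from \<open>b\<close> to \<open>b'\<close>. In this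
  situation the strong set order gives \<open>T\<close> both heights at both slopes, hence
  \<open>c\<close> at every slope in between. It remains to find one slope in between for which
  \<open>S\<close> admits \<open>c\<close>, by the intermediate value argument.\<close>

lemma bisects_Split_between:
  assumes TS: "split_tree_on M (Split \<tau> T S)" and pos: "\<And>A. A \<in> regions (Split \<tau> T S) \<Longrightarrow> 0 < measure M A"
    and T: "interval_bisected M T" "monotonically_bisected M T" and S: "interval_bisected M S"
    and [measurable]: "u \<in> borel_measurable M"
    and b: "bisects M T (\<lambda>\<omega>. u \<omega> - w * \<tau> \<omega>) b" "bisects M S (\<lambda>\<omega>. u \<omega> - w * \<tau> \<omega>) b"
    and b': "bisects M T (\<lambda>\<omega>. u \<omega> - w' * \<tau> \<omega>) b'" "bisects M S (\<lambda>\<omega>. u \<omega> - w' * \<tau> \<omega>) b'"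
    and c: "b \<le> c" "c \<le> b'" and w: "w \<le> w'"
  shows "bisects M (Split \<tau> T S) u c"
proof -
  have [measurable]: "\<tau> \<in> borel_measurable M" using TS by simp
  have \<tau>: "\<tau> \<omega> > 0" if "\<omega> \<in> \<Union>(regions T)" for \<omega> using TS that by auto
  let ?u = "\<lambda>w \<omega>. u \<omega> - w * \<tau> \<omega>"
  have meas: "?u w \<in> borel_measurable M" for w by measurable
  have le: "?u y \<omega> \<le> ?u x \<omega>" if "x \<le> y" "\<omega> \<in> \<Union>(regions T)" for x y \<omega>
    using that \<tau>[OF that(2)] by (simp add: mult_right_mono)
  have bb': "b \<le> b'" using c by simp
  have "bisects M T (?u w') b"
    using monotonically_bisectedD1[OF T(2) meas meas le[OF w] b'(1) b(1) bb'] .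
  then have 1: "bisects M T (?u w') c"
    using interval_bisectedD(2)[OF T(1) meas _ b'(1) c] by blast
  have "bisects M T (?u w) b'"
    using monotonically_bisectedD2[OF T(2) meas meas le[OF w] b'(1) b(1) bb'] .
  then have 2: "bisects M T (?u w) c"
    using interval_bisectedD(2)[OF T(1) meas b(1) _ c] by blast
  obtain w'' where w'': "w'' \<in> closed_segment w w'" "bisects M S (?u w'') c"
    using bisects_ivt[OF _ _ S _ _ b(2) b'(2) c] TS pos by auto
  have "w \<le> w''" "w'' \<le> w'" using w''(1) w by (auto simp: closed_segment_eq_real_ivl)
  from bisects_between[OF T meas meas meas le[OF this(2)] le[OF this(1)] 1 2]
  show ?thesis using w''(2) by auto
qed

text \<open>\<open>T\<close> admits \<open>b'\<close> at every slope from \<open>w'\<close> to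
  \<open>w\<close>, since there the tilted \<open>u\<close> lies between
  \<open>u - w * \<tau>\<close> and \<open>v - w' * \<tau>\<close>, both bisected at
  \<open>b'\<close>. So \<open>S\<close> has to supply only one slope. Compare \<open>b'\<close>
  with any height \<open>d\<close> of \<open>S\<close> at \<open>w'\<close>: if
  \<open>b' \<le> d\<close>, the slope \<open>w'\<close> itself works by comparison with
  \<open>v\<close>; otherwise \<open>d\<close> and \<open>b\<close> enclose \<open>b'\<close>, and a
  slope in between is found.\<close>

lemma bisects_Split_mono:
  assumes TS: "split_tree_on M (Split \<tau> T S)" and pos: "\<And>A. A \<in> regions (Split \<tau> T S) \<Longrightarrow> 0 < measure M A"
    and T: "interval_bisected M T" "monotonically_bisected M T"
    and S: "interval_bisected M S" "monotonically_bisected M S"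
    and [measurable]: "u \<in> borel_measurable M" "v \<in> borel_measurable M"
    and uv: "\<And>\<omega>. \<omega> \<in> \<Union>(regions (Split \<tau> T S)) \<Longrightarrow> u \<omega> \<le> v \<omega>"
    and b: "bisects M T (\<lambda>\<omega>. u \<omega> - w * \<tau> \<omega>) b" "bisects M S (\<lambda>\<omega>. u \<omega> - w * \<tau> \<omega>) b"
    and b': "bisects M T (\<lambda>\<omega>. v \<omega> - w' * \<tau> \<omega>) b'" "bisects M S (\<lambda>\<omega>. v \<omega> - w' * \<tau> \<omega>) b'"
    and c: "b' \<le> b" and w: "w' \<le> w"
  shows "bisects M (Split \<tau> T S) u b'"
proof -
  have [measurable]: "\<tau> \<in> borel_measurable M" using TS by simp
  have \<tau>: "\<tau> \<omega> > 0" if "\<omega> \<in> \<Union>(regions T)" for \<omega> using TS that by auto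
  let ?u = "\<lambda>w \<omega>. u \<omega> - w * \<tau> \<omega>" and ?v = "\<lambda>w \<omega>. v \<omega> - w * \<tau> \<omega>"
  have meas: "?u w \<in> borel_measurable M" "?v w \<in> borel_measurable M" for w by measurable
  have le: "?u y \<omega> \<le> ?u x \<omega>" if "x \<le> y" "\<omega> \<in> \<Union>(regions T)" for x y \<omega>
    using that \<tau>[OF that(2)] by (simp add: mult_right_mono)
  have le': "?u y \<omega> \<le> ?v x \<omega>" if "x \<le> y" "\<omega> \<in> \<Union>(regions T)" for x y \<omega>
    using le[OF that] uv[of \<omega>] that(2) by auto
  have 1: "bisects M T (?u w) b'"
    using monotonically_bisectedD1[OF T(2) meas(1) meas(2) le'[OF w] b(1) b'(1) c] .
  obtain d where d: "bisects M S (?u w') d"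
    using interval_bisectedD(1)[OF S(1) meas(1)] by blast
  have "\<exists>w''\<in>closed_segment w' w. bisects M S (?u w'') b'"
  proof (cases "b' \<le> d")
    case True
    have "bisects M S (?u w') b'"
      by (rule monotonically_bisectedD1[OF S(2) meas(1) meas(2) _ d b'(2) True]) (use uv in auto)
    then show ?thesis by blast
  next
    case False
    then have "d \<le> b'" by simp
    with TS pos show ?thesis
      by (intro bisects_ivt[OF _ _ S(1) _ _ d b(2) _ c]) auto
  qed
  then obtain w'' where w'': "w'' \<in> closed_segment w' w" "bisects M S (?u w'') b'" by blast
  have "w' \<le> w''" "w'' \<le> w" using w''(1) w by (auto simp: closed_segment_eq_real_ivl)
  from bisects_between[OF T meas(1) meas(1) meas(2) le[OF this(2)] le'[OF this(1)] 1 b'(1)]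
  show ?thesis using w''(2) by auto
qed

text \<open>The bisecting heights of one region are its medians. A median is found as the supremum
  of the heights below which at most half of the mass lies; positive mass makes this set nonempty
  and bounded. The order properties follow from monotonicity of the sublevel and superlevel
  sets.\<close>

lemma bisects_Region_properties:
  assumes A: "A \<in> sets M" and pos: "0 < measure M A"
  shows "interval_bisected M (Region A)" "monotonically_bisected M (Region A)"
proof -
  have "A \<subseteq> space M" using sets.sets_into_space[OF A] .
  then have eq: "{\<omega>\<in>A. P \<omega>} = {\<omega>\<in>space M. \<omega> \<in> A \<and> P \<omega>}" for P by auto
  have predA[measurable]: "Measurable.pred M (\<lambda>\<omega>. \<omega> \<in> A)" using A by simp
  have meas: "{\<omega>\<in>A. u \<omega> < b} \<in> sets M" "{\<omega>\<in>A. u \<omega> > b} \<in> sets M"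
    if [measurable]: "u \<in> borel_measurable M" for u and b :: real
    unfolding eq by measurable
  have mono: "measure M {\<omega>\<in>A. u \<omega> < b} \<le> measure M {\<omega>\<in>A. v \<omega> < c}"
       "measure M {\<omega>\<in>A. v \<omega> > c} \<le> measure M {\<omega>\<in>A. u \<omega> > b}"
    if "u \<in> borel_measurable M" "v \<in> borel_measurable M" "\<And>\<omega>. \<omega> \<in> A \<Longrightarrow> v \<omega> \<le> u \<omega>" "b \<le> c"
    for u v and b c :: real
    using that meas by (auto intro!: finite_measure_mono) (metis le_less_trans less_le_trans)+
  have "\<exists>b. bisects M (Region A) u b" if u[measurable]: "u \<in> borel_measurable M" for u
  proof -
    define L where "L = {b. 2 * measure M {\<omega>\<in>A. u \<omega> < b} \<le> measure M A}"
    have down: "b \<in> L" if "c \<in> L" "b \<le> c" for b c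
      using mono(1)[OF u u _ that(2)] that(1) unfolding L_def by force
    have lim: "(\<lambda>n. 2 * measure M {\<omega>\<in>A. P n (u \<omega>)}) \<longlonglongrightarrow> 2 * measure M {\<omega>\<in>A. Q (u \<omega>)}"
      if "\<And>n. {\<omega>\<in>A. P n (u \<omega>)} \<in> sets M" "{\<omega>\<in>A. Q (u \<omega>)} \<in> sets M"
        "\<And>x. \<forall>\<^sub>F n in sequentially. P n x \<longleftrightarrow> Q x" for P Q
    proof (intro tendsto_mult tendsto_const measure_tendsto that(1,2))
      fix \<omega>
      show "\<forall>\<^sub>F n in sequentially. \<omega> \<in> {\<omega>\<in>A. P n (u \<omega>)} \<longleftrightarrow> \<omega> \<in> {\<omega>\<in>A. Q (u \<omega>)}"
        using that(3)[of "u \<omega>"] by eventually_elim auto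
    qed
    have large: "\<forall>\<^sub>F n in sequentially. x < real n" for x
      using filterlim_real_sequentially by (auto simp: filterlim_at_top_dense)
    have inv: "0 < inverse (real (Suc n))" for n by simp
    have small: "\<forall>\<^sub>F n in sequentially. inverse (real (Suc n)) < x" if "x > 0" for x
      using LIMSEQ_inverse_real_of_nat that by (rule order_tendstoD)
    have "(\<lambda>n. 2 * measure M {\<omega>\<in>A. u \<omega> < - real n}) \<longlonglongrightarrow> 2 * measure M {\<omega>\<in>A. False}"
    proof (intro lim)
      show "\<forall>\<^sub>F n in sequentially. x < - real n \<longleftrightarrow> False" for x
        using large[of "- x"] by eventually_elim auto
    qed (use meas[OF u] in auto)
    then have "\<forall>\<^sub>F n in sequentially. 2 * measure M {\<omega>\<in>A. u \<omega> < - real n} < measure M A"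
      by (rule order_tendstoD(2)) (use pos in simp)
    then obtain m where "- real m \<in> L" by (auto simp: L_def eventually_sequentially intro: less_imp_le)
    then have "L \<noteq> {}" by blast
    have "(\<lambda>n. 2 * measure M {\<omega>\<in>A. u \<omega> < real n}) \<longlonglongrightarrow> 2 * measure M {\<omega>\<in>A. True}"
    proof (intro lim)
      show "\<forall>\<^sub>F n in sequentially. x < real n \<longleftrightarrow> True" for x
        using large[of x] by eventually_elim auto
    qed (use meas[OF u] A in auto)
    then have "\<forall>\<^sub>F n in sequentially. 2 * measure M {\<omega>\<in>A. u \<omega> < real n} > measure M A"
      by (rule order_tendstoD(1)) (use pos in simp)
    then obtain n where "real n \<notin> L" by (auto simp: L_def eventually_sequentially not_le)
    then have "bdd_above L" using down by (meson bdd_above.I linear)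
    define b where "b = Sup L"
    have inL: "x \<in> L" if "x < b" for x
      using that less_cSup_iff[OF \<open>L \<noteq> {}\<close> \<open>bdd_above L\<close>] down unfolding b_def by (meson less_imp_le)
    have notL: "x \<notin> L" if "b < x" for x
      using that cSup_upper[OF _ \<open>bdd_above L\<close>] unfolding b_def by force
    \<comment> \<open>From the left: heights just below the supremum belong to \<open>L\<close>, and
      their sublevel sets exhaust \<open>u < b\<close>.\<close>
    have "(\<lambda>n. 2 * measure M {\<omega>\<in>A. u \<omega> < b - inverse (real (Suc n))}) \<longlonglongrightarrow> 2 * measure M {\<omega>\<in>A. u \<omega> < b}"
    proof (rule lim)
      fix x :: real
      show "\<forall>\<^sub>F n in sequentially. x < b - inverse (real (Suc n)) \<longleftrightarrow> x < b"
      proof (cases "x < b")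
        case True
        then have "0 < b - x" by simp
        from small[OF this] show ?thesis by eventually_elim (use True in linarith)
      next
        case False
        have "(x < b - inverse (real (Suc n))) = (x < b)" for n
          using inv[of n] False by linarith
        then show ?thesis by (rule always_eventually[OF allI])
      qed
    qed (use meas[OF u] in auto)
    moreover have "2 * measure M {\<omega>\<in>A. u \<omega> < b - inverse (real (Suc n))} \<le> measure M A" for n
      using inL[of "b - inverse (real (Suc n))"] inv[of n] by (simp add: L_def)
    ultimately have 1: "2 * measure M {\<omega>\<in>A. u \<omega> < b} \<le> measure M A"
      by (blast intro: LIMSEQ_le_const2)
    \<comment> \<open>From the right: heights just above the supremum are outside \<open>L\<close>,
      so less than half of the mass lies at or above them, and these superlevel sets exhaust
      \<open>b < u\<close>.\<close>
    have "(\<lambda>n. 2 * measure M {\<omega>\<in>A. \<not> u \<omega> < b + inverse (real (Suc n))}) \<longlonglongrightarrow> 2 * measure M {\<omega>\<in>A. b < u \<omega>}"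
    proof (rule lim)
      fix x :: real
      show "\<forall>\<^sub>F n in sequentially. \<not> x < b + inverse (real (Suc n)) \<longleftrightarrow> b < x"
      proof (cases "b < x")
        case True
        then have "0 < x - b" by simp
        from small[OF this] show ?thesis by eventually_elim (use True in linarith)
      next
        case False
        have "(\<not> x < b + inverse (real (Suc n))) = (b < x)" for n
          using inv[of n] False by linarith
        then show ?thesis by (rule always_eventually[OF allI])
      qed
      show "{\<omega>\<in>A. \<not> u \<omega> < b + inverse (real (Suc n))} \<in> sets M" for n
        unfolding eq by measurable
    qed (use meas[OF u] in auto)
    moreover have "2 * measure M {\<omega>\<in>A. \<not> u \<omega> < b + inverse (real (Suc n))} \<le> measure M A" for n
    proof -
      let ?B = "{\<omega>\<in>A. u \<omega> < b + inverse (real (Suc n))}"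
      have "2 * measure M ?B > measure M A" using notL[of "b + inverse (real (Suc n))"] by (simp add: L_def)
      moreover have "measure M (A - ?B) = measure M A - measure M ?B"
        using A meas[OF u] by (intro finite_measure_Diff) auto
      moreover have "{\<omega>\<in>A. \<not> u \<omega> < b + inverse (real (Suc n))} = A - ?B" by auto
      ultimately show ?thesis by simp
    qed
    ultimately have "2 * measure M {\<omega>\<in>A. b < u \<omega>} \<le> measure M A"
      by (blast intro: LIMSEQ_le_const2)
    with 1 show ?thesis by auto
  qed
  moreover have "bisects M (Region A) u c"
    if u: "u \<in> borel_measurable M" and "bisects M (Region A) u b" "bisects M (Region A) u b'" "b \<le> c" "c \<le> b'" for u b b' c
    using that mono(1)[OF u u order_refl, of c b'] mono(2)[OF u u order_refl, of b c] by simp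
  ultimately show "interval_bisected M (Region A)"
    unfolding interval_bisected_def by blast
  show "monotonically_bisected M (Region A)"
    unfolding monotonically_bisected_def
  proof (intro ballI allI impI)
    fix u v b b'
    assume "u \<in> borel_measurable M" "v \<in> borel_measurable M"
      "\<forall>\<omega>\<in>\<Union>(regions (Region A)). u \<omega> \<le> v \<omega>"
      "bisects M (Region A) u b" "bisects M (Region A) v b'" "b' \<le> b"
    then show "bisects M (Region A) u b'"
      using mono(1)[of u u b' b] mono(2)[of v u b' b'] by simp
  qed
qed

text \<open>Both properties go through the induction together: convexity at a split uses
  monotonicity on a half, and monotonicity at a split uses existence and convexity on the halves.
  Slopes in the wrong order are dealt with by exchanging the halves.\<close>

lemma bisects_properties:
  assumes "split_tree_on M T" "\<And>A. A \<in> regions T \<Longrightarrow> 0 < measure M A"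
  shows "interval_bisected M T \<and> monotonically_bisected M T"
  using assms
proof (induction T)
  case (Region A)
  then show ?case using bisects_Region_properties by auto
next
  case (Split \<tau> T S)
  have T: "interval_bisected M T" "monotonically_bisected M T"
    and S: "interval_bisected M S" "monotonically_bisected M S"
    using Split by auto
  have swap: "split_tree_on M (Split (\<lambda>\<omega>. - \<tau> \<omega>) S T)"
       "\<And>A. A \<in> regions (Split (\<lambda>\<omega>. - \<tau> \<omega>) S T) \<Longrightarrow> 0 < measure M A"
    using Split.prems by auto
  have "bisects M (Split \<tau> T S) u c"
    if u: "u \<in> borel_measurable M" and bis: "bisects M (Split \<tau> T S) u b" "bisects M (Split \<tau> T S) u b'"
      and c: "b \<le> c" "c \<le> b'" for u b b' c
  proof -
    obtain w w' where w: "bisects M T (\<lambda>\<omega>. u \<omega> - w * \<tau> \<omega>) b" "bisects M S (\<lambda>\<omega>. u \<omega> - w * \<tau> \<omega>) b"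
      "bisects M T (\<lambda>\<omega>. u \<omega> - w' * \<tau> \<omega>) b'" "bisects M S (\<lambda>\<omega>. u \<omega> - w' * \<tau> \<omega>) b'"
      using bis by auto
    show ?thesis
    proof (cases "w \<le> w'")
      case True
      then show ?thesis using bisects_Split_between[OF Split.prems T S(1) u w c] by simp
    next
      case False
      have "bisects M (Split (\<lambda>\<omega>. - \<tau> \<omega>) S T) u c"
        by (rule bisects_Split_between[OF swap S T(1) u _ _ _ _ c, where w = "- w" and w' = "- w'"])
           (use w False in simp_all)
      then show ?thesis using bisects_Split_swap by blast
    qed
  qed
  moreover have "bisects M (Split \<tau> T S) u b'"
    if uv: "u \<in> borel_measurable M" "v \<in> borel_measurable M"
      and le: "\<And>\<omega>. \<omega> \<in> \<Union>(regions (Split \<tau> T S)) \<Longrightarrow> u \<omega> \<le> v \<omega>"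
      and bis: "bisects M (Split \<tau> T S) u b" "bisects M (Split \<tau> T S) v b'"
      and c: "b' \<le> b" for u v b b'
  proof -
    obtain w w' where w: "bisects M T (\<lambda>\<omega>. u \<omega> - w * \<tau> \<omega>) b" "bisects M S (\<lambda>\<omega>. u \<omega> - w * \<tau> \<omega>) b"
      "bisects M T (\<lambda>\<omega>. v \<omega> - w' * \<tau> \<omega>) b'" "bisects M S (\<lambda>\<omega>. v \<omega> - w' * \<tau> \<omega>) b'"
      using bis by auto
    show ?thesis
    proof (cases "w' \<le> w")
      case True
      then show ?thesis using bisects_Split_mono[OF Split.prems T S uv le w c] by blast
    next
      case False
      have "bisects M (Split (\<lambda>\<omega>. - \<tau> \<omega>) S T) u b'"
        by (rule bisects_Split_mono[OF swap S T uv _ _ _ _ _ c, where w = "- w" and w' = "- w'"])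
           (use w le False in auto)
      then show ?thesis using bisects_Split_swap by blast
    qed
  qed
  ultimately show ?case
    using bisects_Split_ex[OF Split.prems T(1) S(1)]
    unfolding interval_bisected_def monotonically_bisected_def by (intro conjI ballI allI impI) blast+
qed

text \<open>For a tree on one side of a split no second half has to agree, so the slope can be spent
  on prescribing the height: as it runs over the reals, the heights go from arbitrarily low to
  arbitrarily high. This is what puts the center at a center of symmetry.\<close>

lemma bisects_slope_ex:
  assumes T: "split_tree_on M T" and pos: "\<And>A. A \<in> regions T \<Longrightarrow> 0 < measure M A"
    and u[measurable]: "u \<in> borel_measurable M" "\<tau> \<in> borel_measurable M"
    and \<tau>: "\<And>\<omega>. \<omega> \<in> \<Union>(regions T) \<Longrightarrow> \<tau> \<omega> > 0"
  shows "\<exists>w. bisects M T (\<lambda>\<omega>. u \<omega> - w * \<tau> \<omega>) c"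
proof -
  have int: "interval_bisected M T" using bisects_properties[OF T pos] by blast
  have ex: "\<exists>b. bisects M T (\<lambda>\<omega>. u \<omega> - w * \<tau> \<omega>) b" for w
    by (rule interval_bisectedD(1)[OF int]) measurable
  from eventually_slope_le[OF T pos u \<tau>, of c]
  obtain k where "\<forall>b. bisects M T (\<lambda>\<omega>. u \<omega> - real k * \<tau> \<omega>) b \<longrightarrow> b \<le> c"
    by (auto simp: eventually_sequentially)
  with ex obtain w1 b1 where 1: "bisects M T (\<lambda>\<omega>. u \<omega> - w1 * \<tau> \<omega>) b1" "b1 \<le> c" by blast
  have "\<forall>\<^sub>F k in sequentially. \<forall>b. bisects M T (\<lambda>\<omega>. u \<omega> - real k * (- \<tau> \<omega>)) b \<longrightarrow> c \<le> b"
    using \<tau> by (intro eventually_slope_ge[OF T pos]) auto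
  then obtain k where "\<forall>b. bisects M T (\<lambda>\<omega>. u \<omega> - (- real k) * \<tau> \<omega>) b \<longrightarrow> c \<le> b"
    by (auto simp: eventually_sequentially)
  with ex obtain w2 b2 where 2: "bisects M T (\<lambda>\<omega>. u \<omega> - w2 * \<tau> \<omega>) b2" "c \<le> b2" by blast
  from bisects_ivt[OF T pos int u 1(1) 2(1) 1(2) 2(2)] show ?thesis by blast
qed

end

section \<open>Cylinders and Yao-Yao partitions\<close>

definition cylinder :: "'a::euclidean_space set \<Rightarrow> 'a \<Rightarrow> 'a set" where
  "cylinder S v = {y + c *\<^sub>R v | y c. y \<in> S}"

lemma cylinderI: "y \<in> S \<Longrightarrow> y + c *\<^sub>R v \<in> cylinder S v"
  by (auto simp: cylinder_def)

lemma subset_cylinder: "S \<subseteq> cylinder S v"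
  using cylinderI[of _ S 0 v] by auto

lemma vec_of_mono: "S \<subseteq> T \<Longrightarrow> vec_of S \<subseteq> vec_of T"
  by (auto simp: vec_of_def)

lemma affine_add_vec_of:
  assumes "affine S" "y \<in> S" "d \<in> vec_of S"
  shows "y + c *\<^sub>R d \<in> S"
proof -
  obtain z w where "z \<in> S" "w \<in> S" "d = z - w" using assms(3) by (auto simp: vec_of_def)
  moreover have "y + c *\<^sub>R (z - w) \<in> S"
    by (rule mem_affine_3_minus[OF assms(1,2) calculation(1,2)])
  ultimately show ?thesis by simp
qed

lemma cylinder_unique:
  assumes S: "affine S" "v \<notin> vec_of S" and yz: "y \<in> S" "z \<in> S" "y + c *\<^sub>R v = z + d *\<^sub>R v"
  shows "c = d \<and> y = z"
proof -
  have "c = d"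
  proof (rule ccontr)
    assume "c \<noteq> d"
    have "(d - c) *\<^sub>R v = y - z" using yz(3) by (simp add: algebra_simps)
    then have "v = (1 / (d - c)) *\<^sub>R (y - z)"
      using \<open>c \<noteq> d\<close> by (metis divide_self_if eq_iff_diff_eq_0 scaleR_one scaleR_scaleR times_divide_eq_left mult_1)
    moreover have "z + (1 / (d - c)) *\<^sub>R (y - z) \<in> S"
      using affine_add_vec_of[OF S(1) yz(2), of "y - z"] yz(1,2) by (auto simp: vec_of_def)
    ultimately have "v \<in> vec_of S" using yz(2) unfolding vec_of_def by (smt (verit) add_diff_cancel_left' mem_Collect_eq)
    with S(2) show False ..
  qed
  with yz(3) show ?thesis by simp
qed

lemma affine_cylinder:
  assumes "affine S"
  shows "affine (cylinder S v)"
  unfolding affine_def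
proof safe
  fix x y and a b :: real
  assume "x \<in> cylinder S v" "y \<in> cylinder S v" and ab: "a + b = 1"
  then obtain x' c y' d where *: "x' \<in> S" "y' \<in> S" "x = x' + c *\<^sub>R v" "y = y' + d *\<^sub>R v"
    by (auto simp: cylinder_def)
  have "a *\<^sub>R x' + b *\<^sub>R y' \<in> S" using assms * ab by (simp add: affine_def)
  moreover have "a *\<^sub>R x + b *\<^sub>R y = (a *\<^sub>R x' + b *\<^sub>R y') + (a * c + b * d) *\<^sub>R v"
    using * by (simp add: algebra_simps)
  ultimately show "a *\<^sub>R x + b *\<^sub>R y \<in> cylinder S v" by (metis cylinderI)
qed

lemma aff_dim_cylinder:
  assumes S: "affine S" "S \<noteq> {}" and v: "v \<notin> vec_of S"
  shows "aff_dim (cylinder S v) = aff_dim S + 1"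
proof -
  obtain s where s: "s \<in> S" using S by blast
  have "cylinder S v = affine hull (insert (s + v) S)"
  proof
    show "cylinder S v \<subseteq> affine hull (insert (s + v) S)"
    proof
      fix x assume "x \<in> cylinder S v"
      then obtain y c where x: "y \<in> S" "x = y + c *\<^sub>R v" by (auto simp: cylinder_def)
      have "y + c *\<^sub>R ((s + v) - s) \<in> affine hull (insert (s + v) S)"
        using x s by (intro mem_affine_3_minus) (auto intro: hull_inc)
      with x show "x \<in> affine hull (insert (s + v) S)" by simp
    qed
    show "affine hull (insert (s + v) S) \<subseteq> cylinder S v"
      using subset_cylinder[of S v] cylinderI[OF s, of 1 v] affine_cylinder[OF S(1)]
      by (intro hull_minimal) auto
  qed
  moreover have "s + v \<notin> S" using v s unfolding vec_of_def by (smt (verit) add_diff_cancel_left' mem_Collect_eq)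
  then have "s + v \<notin> affine hull S" using S by (simp add: hull_same)
  ultimately show ?thesis by (simp add: aff_dim_insert)
qed

lemma hyperplane_cylinder_eq:
  assumes E: "affine E" and F: "affine_hyperplane_of E F" "F \<noteq> {}" and v: "v \<in> vec_of E" "v \<notin> vec_of F"
  shows "E = cylinder F v"
proof -
  have "cylinder F v \<subseteq> E"
    using F affine_add_vec_of[OF E _ v(1)] by (auto simp: cylinder_def affine_hyperplane_of_def)
  moreover have "aff_dim (cylinder F v) = aff_dim E"
    using F v aff_dim_cylinder[of F v] by (simp add: affine_hyperplane_of_def)
  moreover have "affine (cylinder F v)" using F affine_cylinder by (auto simp: affine_hyperplane_of_def)
  moreover have "cylinder F v \<noteq> {}" using F subset_cylinder by blast
  ultimately show ?thesis using E affine_dim_equal by blast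
qed

text \<open>Hyperplanes of the base extend along \<open>v\<close> to hyperplanes of the total space;
  this is why projecting along \<open>v\<close> preserves the condition on hyperplanes.\<close>

lemma hyperplane_cylinder:
  assumes F: "affine F" "H \<noteq> {}" and H: "affine_hyperplane_of F H" and v: "v \<notin> vec_of F"
  shows "affine_hyperplane_of (cylinder F v) (cylinder H v)"
proof -
  have "H \<subseteq> F" "affine H" using H by (auto simp: affine_hyperplane_of_def)
  moreover have "v \<notin> vec_of H" using v vec_of_mono[OF \<open>H \<subseteq> F\<close>] by blast
  moreover have "cylinder H v \<subseteq> cylinder F v" using \<open>H \<subseteq> F\<close> by (auto simp: cylinder_def)
  moreover have "F \<noteq> {}" using \<open>H \<subseteq> F\<close> F by auto
  ultimately show ?thesis
    using aff_dim_cylinder[of F v] aff_dim_cylinder[of H v] F H v affine_cylinder[of H v]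
    by (simp add: affine_hyperplane_of_def)
qed

lemma base_hyperplane_cylinder:
  assumes "affine F" "F \<noteq> {}" "v \<notin> vec_of F"
  shows "affine_hyperplane_of (cylinder F v) F"
  using assms aff_dim_cylinder[of F v] subset_cylinder[of F v] by (simp add: affine_hyperplane_of_def)

lemma vec_of_cylinder:
  assumes "F \<noteq> {}" shows "v \<in> vec_of (cylinder F v)"
proof -
  obtain y where "y \<in> F" using assms by blast
  then have "y + v \<in> cylinder F v" "y \<in> cylinder F v"
    using cylinderI[of y F 1 v] cylinderI[of y F 0 v] by auto
  then show ?thesis unfolding vec_of_def by (smt (verit) add_diff_cancel_left' mem_Collect_eq)
qed

text \<open>The change of splitting data in a lift: a base split with hyperplane \<open>F\<close>
  and vector \<open>v\<close> becomes one with hyperplane \<open>cylinder F e\<close> and vector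
  \<open>v + w *\<^sub>R e\<close>. Tilting only shifts the coordinate along \<open>e\<close>, so
  the same space is filled.\<close>

lemma cylinder_skew: "cylinder (cylinder F v) e = cylinder (cylinder F e) (v + w *\<^sub>R e)"
proof
  show "cylinder (cylinder F v) e \<subseteq> cylinder (cylinder F e) (v + w *\<^sub>R e)"
  proof
    fix y assume "y \<in> cylinder (cylinder F v) e"
    then obtain z a c where z: "z \<in> F" "y = z + a *\<^sub>R v + c *\<^sub>R e" by (auto simp: cylinder_def)
    have "(z + (c - a * w) *\<^sub>R e) + a *\<^sub>R (v + w *\<^sub>R e) \<in> cylinder (cylinder F e) (v + w *\<^sub>R e)"
      using z by (intro cylinderI)
    then show "y \<in> cylinder (cylinder F e) (v + w *\<^sub>R e)" using z by (simp add: algebra_simps)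
  qed
  show "cylinder (cylinder F e) (v + w *\<^sub>R e) \<subseteq> cylinder (cylinder F v) e"
  proof
    fix y assume "y \<in> cylinder (cylinder F e) (v + w *\<^sub>R e)"
    then obtain z a c where z: "z \<in> F" "y = z + c *\<^sub>R e + a *\<^sub>R (v + w *\<^sub>R e)" by (auto simp: cylinder_def)
    have "(z + a *\<^sub>R v) + (c + a * w) *\<^sub>R e \<in> cylinder (cylinder F v) e" using z by (intro cylinderI)
    then show "y \<in> cylinder (cylinder F v) e" using z by (simp add: algebra_simps)
  qed
qed

lemma not_vec_of_skew_cylinder:
  assumes F: "affine F" "v \<notin> vec_of F" and e: "e \<notin> vec_of (cylinder F v)"
  shows "v + w *\<^sub>R e \<notin> vec_of (cylinder F e)"
proof
  assume "v + w *\<^sub>R e \<in> vec_of (cylinder F e)"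
  then obtain y z c c' where yz: "y \<in> F" "z \<in> F" "v + w *\<^sub>R e = (y + c *\<^sub>R e) - (z + c' *\<^sub>R e)"
    by (auto simp: vec_of_def cylinder_def)
  have "z + v \<in> cylinder F v" "y \<in> cylinder F v"
    using yz cylinderI[of z F 1 v] subset_cylinder[of F v] by auto
  moreover have "(z + v) + w *\<^sub>R e = y + (c - c') *\<^sub>R e" using yz(3) by (simp add: algebra_simps)
  ultimately have "z + v = y" using cylinder_unique[OF affine_cylinder[OF F(1)] e] by blast
  then have "v = y - z" by (metis add_diff_cancel_left')
  then have "v \<in> vec_of F" using yz by (auto simp: vec_of_def)
  with F(2) show False ..
qed

text \<open>\<open>d\<close> is the component of \<open>v\<close> orthogonal to the directions of
  \<open>S\<close>, rescaled. The inner product with \<open>d\<close> reads off the coordinate along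
  \<open>v\<close> continuously, which makes this coordinate a measurable function below.\<close>

lemma exists_transversal_functional:
  fixes S :: "'a::euclidean_space set"
  assumes S: "affine S" "S \<noteq> {}" and v: "v \<notin> vec_of S"
  obtains d k where "\<And>y. y \<in> S \<Longrightarrow> d \<bullet> y = k" "d \<bullet> v = 1"
proof -
  obtain s where s: "s \<in> S" using S by blast
  define V where "V = (\<lambda>y. y - s) ` S"
  have V: "subspace V" unfolding V_def
    using affine_diffs_subspace_subtract[OF S(1) s] .
  have "v \<notin> V" using v s by (auto simp: V_def vec_of_def)
  obtain y z where yz: "y \<in> span V" "\<And>w. w \<in> span V \<Longrightarrow> orthogonal z w" "v = y + z"
    using orthogonal_subspace_decomp_exists by metis
  have "z \<noteq> 0" using yz \<open>v \<notin> V\<close> V by (auto simp: span_eq_iff[THEN iffD2])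
  have "z \<bullet> v = z \<bullet> z" using yz by (auto simp: orthogonal_def inner_add_right)
  have "z \<bullet> y = z \<bullet> s" if "y \<in> S" for y
    using yz(2)[of "y - s"] that by (auto simp: V_def orthogonal_def inner_diff_right intro: span_base)
  then have "(z /\<^sub>R (z \<bullet> z)) \<bullet> y = (z \<bullet> s) / (z \<bullet> z)" if "y \<in> S" for y
    using that by (simp add: divide_inverse mult.commute)
  moreover have "(z /\<^sub>R (z \<bullet> z)) \<bullet> v = 1" using \<open>z \<noteq> 0\<close> \<open>z \<bullet> v = z \<bullet> z\<close> by simp
  ultimately show thesis using that by blast
qed

text \<open>A ray sum is the part of a half-space whose projection to \<open>F\<close> along
  \<open>v\<close> falls into \<open>A\<close>, and this projection is continuous. Closedness is
  what makes the cells Borel sets.\<close>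

lemma ray_sums_closed:
  assumes F: "affine F" "v \<notin> vec_of F" and A: "closed A" "A \<subseteq> F"
  shows "closed (ray_sum_pos A v)" "closed (ray_sum_neg A v)"
proof -
  have "closed (ray_sum_pos A v) \<and> closed (ray_sum_neg A v)"
  proof (cases "F = {}")
    case True
    then show ?thesis using A by (auto simp: ray_sum_pos_def ray_sum_neg_def)
  next
    case False
    from F False obtain d k where d: "\<And>y. y \<in> F \<Longrightarrow> d \<bullet> y = k" "d \<bullet> v = 1"
      using exists_transversal_functional by metis
    have 1: "ray_sum_pos A v = (\<lambda>y. y - (d \<bullet> y - k) *\<^sub>R v) -` A \<inter> {y. k \<le> d \<bullet> y}"
    proof safe
      fix y assume "y - (d \<bullet> y - k) *\<^sub>R v \<in> A" "k \<le> d \<bullet> y"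
      then show "y \<in> ray_sum_pos A v" unfolding ray_sum_pos_def
        by (intro CollectI exI[of _ "y - (d \<bullet> y - k) *\<^sub>R v"] exI[of _ "d \<bullet> y - k"]) simp
    qed (use A d in \<open>auto simp: ray_sum_pos_def inner_add_right subset_iff\<close>)
    have 2: "ray_sum_neg A v = (\<lambda>y. y - (d \<bullet> y - k) *\<^sub>R v) -` A \<inter> {y. d \<bullet> y \<le> k}"
    proof safe
      fix y assume "y - (d \<bullet> y - k) *\<^sub>R v \<in> A" "d \<bullet> y \<le> k"
      then show "y \<in> ray_sum_neg A v" unfolding ray_sum_neg_def
        by (intro CollectI exI[of _ "y - (d \<bullet> y - k) *\<^sub>R v"] exI[of _ "d \<bullet> y - k"]) simp
    qed (use A d in \<open>auto simp: ray_sum_neg_def inner_add_right subset_iff\<close>)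
    have "closed ((\<lambda>y. y - (d \<bullet> y - k) *\<^sub>R v) -` A)"
      by (intro closed_vimage A continuous_intros)
    moreover have "closed {y. k \<le> d \<bullet> y}" "closed {y. d \<bullet> y \<le> k}"
      by (intro closed_Collect_le continuous_intros)+
    ultimately show ?thesis unfolding 1 2 by blast
  qed
  then show "closed (ray_sum_pos A v)" "closed (ray_sum_neg A v)" by auto
qed

lemma yao_yao_basic:
  "yao_yao E P x \<Longrightarrow> affine E \<and> x \<in> E \<and> (\<forall>A\<in>P. closed A \<and> A \<subseteq> E)"
proof (induction rule: yao_yao.induct)
  case (step E F v P1 x Pm1)
  then have F: "affine F" "F \<subseteq> E" "F \<noteq> {}" by (auto simp: affine_hyperplane_of_def)
  have "E = cylinder F v" using step F by (intro hyperplane_cylinder_eq) auto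
  moreover have "ray_sum_pos A v \<subseteq> cylinder F v" "ray_sum_neg A v \<subseteq> cylinder F v" if "A \<subseteq> F" for A
    using that by (auto simp: ray_sum_pos_def ray_sum_neg_def cylinder_def)
  ultimately have "A \<subseteq> F \<Longrightarrow> ray_sum_pos A v \<subseteq> E \<and> ray_sum_neg A v \<subseteq> E" for A by blast
  moreover have "x \<in> E" using step F by blast
  moreover have "closed A \<and> A \<subseteq> F" if "A \<in> P1 \<union> Pm1" for A using step that by blast
  ultimately show ?case using step.hyps(1) ray_sums_closed[OF F(1) step.hyps(5)] by (simp add: ball_Un)
qed (auto simp: affine_sing)

section \<open>Null hyperplanes and masses of cells, seen through a map into the space\<close>

definition charges_no_hyperplane ::
    "'b measure \<Rightarrow> 'b set \<Rightarrow> ('b \<Rightarrow> 'a::euclidean_space) \<Rightarrow> 'a set \<Rightarrow> bool" where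
  "charges_no_hyperplane M N q E \<longleftrightarrow>
     (\<forall>H. affine_hyperplane_of E H \<longrightarrow> measure M {\<omega>\<in>N. q \<omega> \<in> H} = 0)"

lemma sets_preimage_closed:
  assumes "N \<in> sets M" "q \<in> borel_measurable M" "closed A"
  shows "{\<omega>\<in>N. q \<omega> \<in> A} \<in> sets M"
proof -
  have "{\<omega>\<in>N. q \<omega> \<in> A} = q -` A \<inter> space M \<inter> N"
    using sets.sets_into_space[OF assms(1)] by auto
  then show ?thesis using assms by (simp add: measurable_sets borel_closed sets.Int)
qed

text \<open>Whatever \<open>f\<close> sends into \<open>H\<close> is sent by \<open>q\<close> into
  \<open>cylinder H v\<close>, a null hyperplane of the larger space. Allowing a subset
  \<open>N'\<close> gives the condition for both halves of a split.\<close>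

lemma (in finite_measure) charges_no_hyperplane_shadow:
  fixes q f :: "'a \<Rightarrow> 'b::euclidean_space"
  assumes F: "affine F" "v \<notin> vec_of F" and N: "N \<in> sets M" "N' \<subseteq> N"
    and q: "q \<in> borel_measurable M"
    and qf: "\<And>\<omega>. \<omega> \<in> N \<Longrightarrow> f \<omega> \<in> F" "\<And>\<omega>. \<omega> \<in> N \<Longrightarrow> q \<omega> = f \<omega> + \<tau> \<omega> *\<^sub>R v"
    and null: "charges_no_hyperplane M N q (cylinder F v)"
  shows "charges_no_hyperplane M N' f F"
  unfolding charges_no_hyperplane_def
proof (intro allI impI)
  fix H assume H: "affine_hyperplane_of F H"
  show "measure M {\<omega>\<in>N'. f \<omega> \<in> H} = 0"
  \<comment> \<open>The empty set has dimension -1 and so counts as a hyperplane of a point, but its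
    cylinder is empty again and not a hyperplane of the line.\<close>
  proof (cases "H = {}")
    case False
    have hyp: "affine_hyperplane_of (cylinder F v) (cylinder H v)"
      by (rule hyperplane_cylinder[OF F(1) False H F(2)])
    then have "closed (cylinder H v)" by (simp add: affine_hyperplane_of_def affine_closed)
    then have "measure M {\<omega>\<in>N'. f \<omega> \<in> H} \<le> measure M {\<omega>\<in>N. q \<omega> \<in> cylinder H v}"
      using qf N cylinderI[of _ H _ v] by (intro finite_measure_mono sets_preimage_closed N q) auto
    also have "\<dots> = 0" using null hyp by (simp add: charges_no_hyperplane_def)
    finally show ?thesis by (simp add: measure_le_0_iff)
  qed simp
qed

text \<open>Opposite ray sums can meet only inside \<open>F\<close>, which is null as a hyperplane
  of the cylinder. Hence the closed sign conditions of the cells may be exchanged for the strict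
  ones that \<open>split_tree_on\<close> demands.\<close>

lemma (in finite_measure) measure_ray_sums:
  fixes q f :: "'a \<Rightarrow> 'b::euclidean_space"
  assumes F: "affine F" "v \<notin> vec_of F" and N: "N \<in> sets M"
    and q: "q \<in> borel_measurable M" "f \<in> borel_measurable M" "\<tau> \<in> borel_measurable M"
    and qf: "\<And>\<omega>. \<omega> \<in> N \<Longrightarrow> f \<omega> \<in> F" "\<And>\<omega>. \<omega> \<in> N \<Longrightarrow> q \<omega> = f \<omega> + \<tau> \<omega> *\<^sub>R v"
    and null: "charges_no_hyperplane M N q (cylinder F v)"
    and A: "closed A" "A \<subseteq> F"
  shows "measure M {\<omega>\<in>N. q \<omega> \<in> ray_sum_pos A v} = measure M {\<omega>\<in>{\<omega>\<in>N. 0 < \<tau> \<omega>}. f \<omega> \<in> A}"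
    and "measure M {\<omega>\<in>N. q \<omega> \<in> ray_sum_neg A v} = measure M {\<omega>\<in>{\<omega>\<in>N. \<tau> \<omega> < 0}. f \<omega> \<in> A}"
proof -
  note q [measurable]
  have eq: "{\<omega>\<in>N. P \<omega>} = {\<omega>\<in>space M. \<omega> \<in> N \<and> P \<omega>}" for P
    using sets.sets_into_space[OF N] by auto
  have [measurable]: "Measurable.pred M (\<lambda>\<omega>. \<omega> \<in> N)" using N by simp
  have N0: "{\<omega>\<in>N. q \<omega> \<in> F} \<in> null_sets M"
  proof (cases "F = {}")
    case False
    have "closed F" using F affine_closed by blast
    moreover have "measure M {\<omega>\<in>N. q \<omega> \<in> F} = 0"
      using null base_hyperplane_cylinder[OF F(1) False F(2)] by (simp add: charges_no_hyperplane_def)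
    ultimately show ?thesis
      using sets_preimage_closed[OF N q(1)] by (simp add: null_sets_def emeasure_eq_measure)
  qed simp
  have pos: "q \<omega> \<in> ray_sum_pos A v \<longleftrightarrow> 0 \<le> \<tau> \<omega> \<and> f \<omega> \<in> A" and neg: "q \<omega> \<in> ray_sum_neg A v \<longleftrightarrow> \<tau> \<omega> \<le> 0 \<and> f \<omega> \<in> A"
    if "\<omega> \<in> N" for \<omega>
    using cylinder_unique[OF F qf(1)[OF that]] A(2) qf(2)[OF that]
    unfolding ray_sum_pos_def ray_sum_neg_def by (auto simp: subset_iff)
  have ae: "AE \<omega> in M. \<omega> \<in> N \<longrightarrow> \<tau> \<omega> \<noteq> 0"
  proof (rule AE_I'[OF N0], safe)
    fix \<omega> assume "\<omega> \<in> N" "\<tau> \<omega> = 0"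
    then show "q \<omega> \<in> F" using qf by simp
  qed
  have A': "{\<omega>\<in>space M. f \<omega> \<in> A} \<in> sets M" by (rule sets_preimage_closed[OF sets.top q(2) A(1)])
  then have [measurable]: "Measurable.pred M (\<lambda>\<omega>. f \<omega> \<in> A)" by (simp add: pred_def)
  have "measure M {\<omega>\<in>N. q \<omega> \<in> ray_sum_pos A v} = measure M {\<omega>\<in>N. 0 \<le> \<tau> \<omega> \<and> f \<omega> \<in> A}"
    using pos by (intro arg_cong[where f = "measure M"]) auto
  also have "\<dots> = measure M {\<omega>\<in>{\<omega>\<in>N. 0 < \<tau> \<omega>}. f \<omega> \<in> A}"
    unfolding mem_Collect_eq eq
    by (rule finite_measure_eq_AE) (use ae in \<open>auto elim!: eventually_mono\<close>)
  finally show "measure M {\<omega>\<in>N. q \<omega> \<in> ray_sum_pos A v} = measure M {\<omega>\<in>{\<omega>\<in>N. 0 < \<tau> \<omega>}. f \<omega> \<in> A}" .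
  have "measure M {\<omega>\<in>N. q \<omega> \<in> ray_sum_neg A v} = measure M {\<omega>\<in>N. \<tau> \<omega> \<le> 0 \<and> f \<omega> \<in> A}"
    using neg by (intro arg_cong[where f = "measure M"]) auto
  also have "\<dots> = measure M {\<omega>\<in>{\<omega>\<in>N. \<tau> \<omega> < 0}. f \<omega> \<in> A}"
    unfolding mem_Collect_eq eq
    by (rule finite_measure_eq_AE) (use ae in \<open>auto elim!: eventually_mono\<close>)
  finally show "measure M {\<omega>\<in>N. q \<omega> \<in> ray_sum_neg A v} = measure M {\<omega>\<in>{\<omega>\<in>N. \<tau> \<omega> < 0}. f \<omega> \<in> A}" .
qed

lemma ray_sum_singleton:
  "ray_sum_pos {x} v = {x + t *\<^sub>R v | t. t \<ge> 0}" "ray_sum_neg {x} v = {x + t *\<^sub>R v | t. t \<le> 0}"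
  by (auto simp: ray_sum_pos_def ray_sum_neg_def)

text \<open>The tree is produced before \<open>u\<close> and \<open>b\<close> are chosen. This order
  of quantifiers carries the induction: the halves are used with the tilted function
  \<open>u - w * \<tau>\<close>, whose slope is known only once a bisecting height of the whole tree
  is given. The masses of the regions are those of base cells, and every lifted cell takes half the
  mass of a base cell.\<close>

lemma lift_partition:
  fixes e :: "'a::euclidean_space" and p :: "'b \<Rightarrow> 'a"
  assumes "yao_yao E P x" "finite_measure M"
    and "e \<notin> vec_of E" "N \<in> sets M" "p \<in> borel_measurable M" "\<And>\<omega>. \<omega> \<in> N \<Longrightarrow> p \<omega> \<in> E"
    and "charges_no_hyperplane M N p E"
  shows "\<exists>T. split_tree_on M T
    \<and> (\<forall>A\<in>regions T. A \<subseteq> N \<and> (\<exists>B\<in>P. measure M A = measure M {\<omega>\<in>N. p \<omega> \<in> B}))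
    \<and> (\<forall>u b. u \<in> borel_measurable M \<longrightarrow>
        charges_no_hyperplane M N (\<lambda>\<omega>. p \<omega> + u \<omega> *\<^sub>R e) (cylinder E e) \<longrightarrow> bisects M T u b \<longrightarrow>
        (\<exists>Q. yao_yao (cylinder E e) Q (x + b *\<^sub>R e) \<and> (\<forall>A\<in>Q. \<exists>B\<in>P.
          2 * measure M {\<omega>\<in>N. p \<omega> + u \<omega> *\<^sub>R e \<in> A} = measure M {\<omega>\<in>N. p \<omega> \<in> B})))"
  using assms(1,3-)
proof (induction arbitrary: N p rule: yao_yao.induct)
  case (base x)
  interpret finite_measure M by fact
  have p: "p \<omega> = x" if "\<omega> \<in> N" for \<omega> using base that by auto
  have N: "N \<in> sets M" by fact
  have [measurable]: "Measurable.pred M (\<lambda>\<omega>. \<omega> \<in> N)" using N by simp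
  have eq: "{\<omega>\<in>N. P \<omega>} = {\<omega>\<in>space M. \<omega> \<in> N \<and> P \<omega>}" for P
    using sets.sets_into_space[OF N] by auto
  have aff: "affine {x}" "{x} \<noteq> {}" by (auto simp: affine_sing)
  have pN: "{\<omega>\<in>N. p \<omega> \<in> {x}} = N" using p by auto
  have "\<exists>Q. yao_yao (cylinder {x} e) Q (x + b *\<^sub>R e) \<and> (\<forall>A\<in>Q. \<exists>B\<in>{{x}}.
          2 * measure M {\<omega>\<in>N. p \<omega> + u \<omega> *\<^sub>R e \<in> A} = measure M {\<omega>\<in>N. p \<omega> \<in> B})"
    if [measurable]: "u \<in> borel_measurable M"
      and null: "charges_no_hyperplane M N (\<lambda>\<omega>. p \<omega> + u \<omega> *\<^sub>R e) (cylinder {x} e)"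
      and bis: "bisects M (Region N) u b" for u b
  proof -
    let ?y = "x + b *\<^sub>R e"
    have e0: "e \<noteq> 0" using base.prems(1) by (auto simp: vec_of_def)
    have dim: "aff_dim (cylinder {x} e) = 1" using aff_dim_cylinder[OF aff base.prems(1)] by simp
    have hyp: "affine_hyperplane_of (cylinder {x} e) {?y}"
      using dim by (auto simp: affine_hyperplane_of_def cylinder_def affine_sing)
    have yao: "yao_yao (cylinder {x} e) ((\<lambda>A. ray_sum_neg A e) ` {{?y}} \<union> (\<lambda>A. ray_sum_pos A e) ` {{?y}}) ?y"
      using dim hyp vec_of_cylinder[of "{x}" e] e0 affine_cylinder[OF aff(1)]
      by (intro yao_yao.step) (auto simp: vec_of_def intro: yao_yao.base)
    \<comment> \<open>The weak inequalities of a median become equalities because the level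
      \<open>u = b\<close> is the preimage of a point, which is a hyperplane of the line.\<close>
    have "{\<omega>\<in>N. p \<omega> + u \<omega> *\<^sub>R e \<in> {?y}} = {\<omega>\<in>N. u \<omega> = b}" using p e0 by auto
    moreover have "measure M {\<omega>\<in>N. p \<omega> + u \<omega> *\<^sub>R e \<in> {?y}} = 0"
      using null hyp unfolding charges_no_hyperplane_def by blast
    ultimately have 0: "measure M {\<omega>\<in>N. u \<omega> = b} = 0" by simp
    have s: "{\<omega>\<in>N. u \<omega> < b} \<in> sets M" "{\<omega>\<in>N. u \<omega> = b} \<in> sets M" "{\<omega>\<in>N. u \<omega> > b} \<in> sets M"
      unfolding eq by measurable
    have un: "measure M ({\<omega>\<in>N. u \<omega> < b} \<union> {\<omega>\<in>N. u \<omega> = b}) = measure M {\<omega>\<in>N. u \<omega> < b}"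
        "measure M ({\<omega>\<in>N. u \<omega> > b} \<union> {\<omega>\<in>N. u \<omega> = b}) = measure M {\<omega>\<in>N. u \<omega> > b}"
      by (subst finite_measure_Union; use s 0 in auto)+
    have "measure M N = measure M ({\<omega>\<in>N. u \<omega> < b} \<union> {\<omega>\<in>N. u \<omega> = b} \<union> {\<omega>\<in>N. u \<omega> > b})"
      by (rule arg_cong[where f = "measure M"]) auto
    also have "\<dots> = measure M {\<omega>\<in>N. u \<omega> < b} + measure M {\<omega>\<in>N. u \<omega> > b}"
      unfolding un(1)[symmetric] by (rule finite_measure_Union) (use s in auto)
    finally have half: "2 * measure M {\<omega>\<in>N. u \<omega> < b} = measure M N" "2 * measure M {\<omega>\<in>N. u \<omega> > b} = measure M N"
      using bis by auto
    have shift: "x + c *\<^sub>R e = ?y + t *\<^sub>R e \<longleftrightarrow> c = b + t" for c t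
      using e0 by (simp add: scaleR_add_left[symmetric] add.assoc)
    have "{\<omega>\<in>N. p \<omega> + u \<omega> *\<^sub>R e \<in> ray_sum_pos {?y} e} = {\<omega>\<in>N. u \<omega> > b} \<union> {\<omega>\<in>N. u \<omega> = b}"
      by (auto simp: ray_sum_singleton p shift intro: exI[of _ "u _ - b"])
    moreover have "{\<omega>\<in>N. p \<omega> + u \<omega> *\<^sub>R e \<in> ray_sum_neg {?y} e} = {\<omega>\<in>N. u \<omega> < b} \<union> {\<omega>\<in>N. u \<omega> = b}"
      by (auto simp: ray_sum_singleton p shift intro: exI[of _ "u _ - b"])
    ultimately have "\<forall>A\<in>(\<lambda>A. ray_sum_neg A e) ` {{?y}} \<union> (\<lambda>A. ray_sum_pos A e) ` {{?y}}. \<exists>B\<in>{{x}}.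
        2 * measure M {\<omega>\<in>N. p \<omega> + u \<omega> *\<^sub>R e \<in> A} = measure M {\<omega>\<in>N. p \<omega> \<in> B}"
      using half un pN by (simp del: singleton_iff)
    with yao show ?thesis by blast
  qed
  then show ?case using N pN by (intro exI[of _ "Region N"]) auto
next
  case (step E F v P1 x Pm1)
  interpret finite_measure M by fact
  have F: "affine F" "F \<subseteq> E" "x \<in> F" using step.hyps yao_yao_basic by (auto simp: affine_hyperplane_of_def)
  have EF: "E = cylinder F v" using step.hyps F by (intro hyperplane_cylinder_eq) auto
  have Fne: "F \<noteq> {}" using F by auto
  obtain d k where d: "\<And>y. y \<in> F \<Longrightarrow> d \<bullet> y = k" "d \<bullet> v = 1"
    using exists_transversal_functional[OF F(1) Fne step.hyps(5)] by metis
  define \<tau> where "\<tau> = (\<lambda>\<omega>. d \<bullet> p \<omega> - k)"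
  define f where "f = (\<lambda>\<omega>. p \<omega> - \<tau> \<omega> *\<^sub>R v)"
  note N = step.prems(2) and pm[measurable] = step.prems(3) and pE = step.prems(4) and pnull = step.prems(5)
  have [measurable]: "Measurable.pred M (\<lambda>\<omega>. \<omega> \<in> N)" using N by simp
  have \<tau>m[measurable]: "\<tau> \<in> borel_measurable M" unfolding \<tau>_def by measurable
  have fm[measurable]: "f \<in> borel_measurable M" unfolding f_def by measurable
  have pf: "p \<omega> = f \<omega> + \<tau> \<omega> *\<^sub>R v" for \<omega> by (simp add: f_def)
  have fF: "f \<omega> \<in> F" if \<omega>: "\<omega> \<in> N" for \<omega>
  proof -
    obtain y c where "y \<in> F" "p \<omega> = y + c *\<^sub>R v" using pE[OF \<omega>] by (auto simp: EF cylinder_def)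
    then show ?thesis using d by (simp add: f_def \<tau>_def inner_add_right)
  qed
  have eF: "e \<notin> vec_of F" using step.prems(1) vec_of_mono[OF F(2)] by blast
  let ?N = "{\<omega>\<in>N. 0 < \<tau> \<omega>}" and ?N' = "{\<omega>\<in>N. \<tau> \<omega> < 0}"
  have eq: "{\<omega>\<in>N. P \<omega>} = {\<omega>\<in>space M. \<omega> \<in> N \<and> P \<omega>}" for P
    using sets.sets_into_space[OF N] by auto
  have Ns: "?N \<in> sets M" "?N' \<in> sets M" unfolding eq by measurable
  have fnull: "charges_no_hyperplane M ?N f F" "charges_no_hyperplane M ?N' f F"
    by (rule charges_no_hyperplane_shadow[OF F(1) step.hyps(5) N _ pm fF pf pnull[unfolded EF]]; auto)+
  have cl: "closed A \<and> A \<subseteq> F" if "A \<in> P1 \<union> Pm1" for A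
    using that step.hyps yao_yao_basic by blast
  let ?P = "(\<lambda>A. ray_sum_neg A v) ` Pm1 \<union> (\<lambda>A. ray_sum_pos A v) ` P1"
  have mpos: "measure M {\<omega>\<in>N. p \<omega> \<in> ray_sum_pos A v} = measure M {\<omega>\<in>?N. f \<omega> \<in> A}" if "A \<in> P1" for A
    using cl that by (intro measure_ray_sums(1)[OF F(1) step.hyps(5) N pm fm \<tau>m fF pf pnull[unfolded EF]]) auto
  have mneg: "measure M {\<omega>\<in>N. p \<omega> \<in> ray_sum_neg A v} = measure M {\<omega>\<in>?N'. f \<omega> \<in> A}" if "A \<in> Pm1" for A
    using cl that by (intro measure_ray_sums(2)[OF F(1) step.hyps(5) N pm fm \<tau>m fF pf pnull[unfolded EF]]) auto
  obtain T where T: "split_tree_on M T"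
    "\<And>A. A \<in> regions T \<Longrightarrow> A \<subseteq> ?N \<and> (\<exists>B\<in>P1. measure M A = measure M {\<omega>\<in>?N. f \<omega> \<in> B})"
    "\<And>u b. u \<in> borel_measurable M \<Longrightarrow>
        charges_no_hyperplane M ?N (\<lambda>\<omega>. f \<omega> + u \<omega> *\<^sub>R e) (cylinder F e) \<Longrightarrow> bisects M T u b \<Longrightarrow>
        (\<exists>Q. yao_yao (cylinder F e) Q (x + b *\<^sub>R e) \<and> (\<forall>A\<in>Q. \<exists>B\<in>P1.
          2 * measure M {\<omega>\<in>?N. f \<omega> + u \<omega> *\<^sub>R e \<in> A} = measure M {\<omega>\<in>?N. f \<omega> \<in> B}))"
    using step.IH(1)[OF eF Ns(1) fm _ fnull(1)] fF by auto
  obtain S where S: "split_tree_on M S"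
    "\<And>A. A \<in> regions S \<Longrightarrow> A \<subseteq> ?N' \<and> (\<exists>B\<in>Pm1. measure M A = measure M {\<omega>\<in>?N'. f \<omega> \<in> B})"
    "\<And>u b. u \<in> borel_measurable M \<Longrightarrow>
        charges_no_hyperplane M ?N' (\<lambda>\<omega>. f \<omega> + u \<omega> *\<^sub>R e) (cylinder F e) \<Longrightarrow> bisects M S u b \<Longrightarrow>
        (\<exists>Q. yao_yao (cylinder F e) Q (x + b *\<^sub>R e) \<and> (\<forall>A\<in>Q. \<exists>B\<in>Pm1.
          2 * measure M {\<omega>\<in>?N'. f \<omega> + u \<omega> *\<^sub>R e \<in> A} = measure M {\<omega>\<in>?N'. f \<omega> \<in> B}))"
    using step.IH(2)[OF eF Ns(2) fm _ fnull(2)] fF by auto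
  have tree: "split_tree_on M (Split \<tau> T S)"
    using T(1,2) S(1,2) by auto
  have regs: "A \<subseteq> N \<and> (\<exists>B\<in>?P. measure M A = measure M {\<omega>\<in>N. p \<omega> \<in> B})" if "A \<in> regions (Split \<tau> T S)" for A
  proof -
    from that have "A \<in> regions T \<or> A \<in> regions S" by simp
    then show ?thesis
    proof
      assume "A \<in> regions T"
      then obtain B where B: "A \<subseteq> ?N" "B \<in> P1" "measure M A = measure M {\<omega>\<in>?N. f \<omega> \<in> B}"
        using T(2) by blast
      then have "measure M A = measure M {\<omega>\<in>N. p \<omega> \<in> ray_sum_pos B v}" "ray_sum_pos B v \<in> ?P" "A \<subseteq> N"
        using mpos by auto
      then show ?thesis by blast
    next
      assume "A \<in> regions S"
      then obtain B where B: "A \<subseteq> ?N'" "B \<in> Pm1" "measure M A = measure M {\<omega>\<in>?N'. f \<omega> \<in> B}"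
        using S(2) by blast
      then have "measure M A = measure M {\<omega>\<in>N. p \<omega> \<in> ray_sum_neg B v}" "ray_sum_neg B v \<in> ?P" "A \<subseteq> N"
        using mneg by auto
      then show ?thesis by blast
    qed
  qed
  have "\<exists>Q. yao_yao (cylinder E e) Q (x + b *\<^sub>R e) \<and> (\<forall>A\<in>Q. \<exists>B\<in>?P.
          2 * measure M {\<omega>\<in>N. p \<omega> + u \<omega> *\<^sub>R e \<in> A} = measure M {\<omega>\<in>N. p \<omega> \<in> B})"
    if um[measurable]: "u \<in> borel_measurable M"
      and null: "charges_no_hyperplane M N (\<lambda>\<omega>. p \<omega> + u \<omega> *\<^sub>R e) (cylinder E e)"
      and bis: "bisects M (Split \<tau> T S) u b" for u b
  proof -
    from bis obtain w where w: "bisects M T (\<lambda>\<omega>. u \<omega> - w * \<tau> \<omega>) b" "bisects M S (\<lambda>\<omega>. u \<omega> - w * \<tau> \<omega>) b"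
      by auto
    let ?G = "cylinder F e" and ?v = "v + w *\<^sub>R e"
    let ?g = "\<lambda>\<omega>. f \<omega> + (u \<omega> - w * \<tau> \<omega>) *\<^sub>R e" and ?q = "\<lambda>\<omega>. p \<omega> + u \<omega> *\<^sub>R e"
    have aG: "affine ?G" "?G \<noteq> {}" using affine_cylinder[OF F(1)] subset_cylinder[of F e] Fne by auto
    have vG: "?v \<notin> vec_of ?G"
      using not_vec_of_skew_cylinder[OF F(1) step.hyps(5)] step.prems(1) by (simp add: EF)
    have EG: "cylinder E e = cylinder ?G ?v"
      unfolding EF by (rule cylinder_skew)
    have gm: "?g \<in> borel_measurable M" and qm: "?q \<in> borel_measurable M"
      and hm: "(\<lambda>\<omega>. u \<omega> - w * \<tau> \<omega>) \<in> borel_measurable M" by measurable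
    have gG: "?g \<omega> \<in> ?G" if "\<omega> \<in> N" for \<omega> using fF[OF that] by (intro cylinderI)
    \<comment> \<open>Skew coordinates of the lifted point: relative to \<open>?G\<close> and
      \<open>?v\<close> the coordinate \<open>\<tau>\<close> is unchanged, while the height over
      \<open>F\<close> becomes \<open>u - w * \<tau>\<close>. Thus the slope in
      \<open>bisects\<close> is exactly the tilt of the splitting vector.\<close>
    have qg: "?q \<omega> = ?g \<omega> + \<tau> \<omega> *\<^sub>R ?v" for \<omega> by (simp add: pf algebra_simps)
    have gnull: "charges_no_hyperplane M ?N ?g ?G" "charges_no_hyperplane M ?N' ?g ?G"
      by (rule charges_no_hyperplane_shadow[OF aG(1) vG N _ qm gG qg null[unfolded EG]]; auto)+
    obtain Q1 where Q1: "yao_yao ?G Q1 (x + b *\<^sub>R e)" "\<And>A. A \<in> Q1 \<Longrightarrow> \<exists>B\<in>P1.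
          2 * measure M {\<omega>\<in>?N. ?g \<omega> \<in> A} = measure M {\<omega>\<in>?N. f \<omega> \<in> B}"
      using T(3)[OF hm gnull(1) w(1)] by blast
    obtain Q2 where Q2: "yao_yao ?G Q2 (x + b *\<^sub>R e)" "\<And>A. A \<in> Q2 \<Longrightarrow> \<exists>B\<in>Pm1.
          2 * measure M {\<omega>\<in>?N'. ?g \<omega> \<in> A} = measure M {\<omega>\<in>?N'. f \<omega> \<in> B}"
      using S(3)[OF hm gnull(2) w(2)] by blast
    have clQ: "closed A \<and> A \<subseteq> ?G" if "A \<in> Q1 \<union> Q2" for A
      using that Q1(1) Q2(1) yao_yao_basic by blast
    let ?Q = "(\<lambda>A. ray_sum_neg A ?v) ` Q2 \<union> (\<lambda>A. ray_sum_pos A ?v) ` Q1"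
    have "aff_dim ?G \<ge> 0" using aG(2) aff_dim_geq[of ?G] aff_dim_empty[of ?G] by linarith
    then have "yao_yao (cylinder E e) ?Q (x + b *\<^sub>R e)"
      unfolding EG using Q1(1) Q2(1) aG vG
      by (intro yao_yao.step) (auto intro: affine_cylinder base_hyperplane_cylinder vec_of_cylinder simp: aff_dim_cylinder)
    moreover have "\<exists>B\<in>?P. 2 * measure M {\<omega>\<in>N. ?q \<omega> \<in> A} = measure M {\<omega>\<in>N. p \<omega> \<in> B}" if "A \<in> ?Q" for A
      using that
    proof (elim UnE imageE)
      fix B assume B: "B \<in> Q1" "A = ray_sum_pos B ?v"
      have "measure M {\<omega>\<in>N. ?q \<omega> \<in> A} = measure M {\<omega>\<in>?N. ?g \<omega> \<in> B}"
        unfolding B using clQ[of B] B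
        by (intro measure_ray_sums(1)[OF aG(1) vG N qm gm \<tau>m gG qg null[unfolded EG]]) auto
      moreover obtain C where "C \<in> P1" "2 * measure M {\<omega>\<in>?N. ?g \<omega> \<in> B} = measure M {\<omega>\<in>?N. f \<omega> \<in> C}"
        using Q1(2)[OF B(1)] by blast
      ultimately have "2 * measure M {\<omega>\<in>N. ?q \<omega> \<in> A} = measure M {\<omega>\<in>N. p \<omega> \<in> ray_sum_pos C v}"
        using mpos by simp
      then show ?thesis using \<open>C \<in> P1\<close> by blast
    next
      fix B assume B: "B \<in> Q2" "A = ray_sum_neg B ?v"
      have "measure M {\<omega>\<in>N. ?q \<omega> \<in> A} = measure M {\<omega>\<in>?N'. ?g \<omega> \<in> B}"
        unfolding B using clQ[of B] B
        by (intro measure_ray_sums(2)[OF aG(1) vG N qm gm \<tau>m gG qg null[unfolded EG]]) auto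
      moreover obtain C where "C \<in> Pm1" "2 * measure M {\<omega>\<in>?N'. ?g \<omega> \<in> B} = measure M {\<omega>\<in>?N'. f \<omega> \<in> C}"
        using Q2(2)[OF B(1)] by blast
      ultimately have "2 * measure M {\<omega>\<in>N. ?q \<omega> \<in> A} = measure M {\<omega>\<in>N. p \<omega> \<in> ray_sum_neg C v}"
        using mneg by simp
      then show ?thesis using \<open>C \<in> Pm1\<close> by blast
    qed
    ultimately show ?thesis by blast
  qed
  then show ?case using tree regs by (intro exI[of _ "Split \<tau> T S"]) blast
qed

section \<open>Equipartitions\<close>

text \<open>\<open>F\<close> is the slice of \<open>E\<close> perpendicular to a difference
  \<open>y - x\<close>. It passes through the given \<open>x\<close>, so projecting along
  \<open>e\<close> fixes \<open>x\<close> and a symmetric measure keeps its center.\<close>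

lemma exists_cylinder_decomposition:
  fixes E :: "'a::euclidean_space set"
  assumes E: "affine E" "x \<in> E" "aff_dim E \<ge> 1"
  obtains F e d where "affine F" "x \<in> F" "e \<notin> vec_of F" "E = cylinder F e"
    "\<And>y. y \<in> F \<Longrightarrow> d \<bullet> y = d \<bullet> x" "d \<bullet> e = 1"
proof -
  have "E \<noteq> {x}" using E(3) by auto
  then obtain y where y: "y \<in> E" "y \<noteq> x" using E(2) by blast
  define e where "e = y - x"
  define d where "d = e /\<^sub>R (e \<bullet> e)"
  define F where "F = E \<inter> {z. d \<bullet> z = d \<bullet> x}"
  have e: "e \<in> vec_of E" using y E by (auto simp: e_def vec_of_def)
  have de: "d \<bullet> e = 1" using y by (simp add: d_def e_def)
  have "affine F" unfolding F_def using E(1) affine_hyperplane by (rule affine_Int)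
  moreover have "e \<notin> vec_of F"
  proof
    assume "e \<in> vec_of F"
    then have "d \<bullet> e = 0" by (auto simp: vec_of_def F_def inner_diff_right)
    with de show False by simp
  qed
  moreover have "E = cylinder F e"
  proof
    show "E \<subseteq> cylinder F e"
    proof
      fix z assume z: "z \<in> E"
      have "z + (- (d \<bullet> z - d \<bullet> x)) *\<^sub>R e \<in> F"
        using affine_add_vec_of[OF E(1) z e, of "- (d \<bullet> z - d \<bullet> x)"] de by (simp add: F_def inner_add_right)
      from cylinderI[OF this, of "d \<bullet> z - d \<bullet> x" e] show "z \<in> cylinder F e" by (simp add: algebra_simps)
    qed
    show "cylinder F e \<subseteq> E"
      using affine_add_vec_of[OF E(1) _ e] by (auto simp: cylinder_def F_def)
  qed
  moreover have "x \<in> F" "\<And>y. y \<in> F \<Longrightarrow> d \<bullet> y = d \<bullet> x" using E(2) by (auto simp: F_def)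
  ultimately show thesis using that de by blast
qed

lemma aff_dim_zero_singleton:
  assumes "aff_dim E = 0" "x \<in> E"
  shows "E = {x}"
  using assms aff_dim_eq_0 by (metis singletonD)

text \<open>Equal masses leave two cases: all regions are null and any choice works, or all have
  positive mass. The parameter \<open>a\<close> stands for the height in the general case and for
  the slope in the symmetric one.\<close>

lemma (in finite_measure) bisects_ex_of_uniform:
  assumes T: "split_tree_on M T" and N: "N \<in> sets M" "c > 0"
    and regs: "\<And>A. A \<in> regions T \<Longrightarrow> A \<subseteq> N \<and> c * measure M A = measure M N"
    and bis: "(\<And>A. A \<in> regions T \<Longrightarrow> 0 < measure M A) \<Longrightarrow> \<exists>a. bisects M T (u a) (b a)"
  shows "\<exists>a. bisects M T (u a) (b a)"
proof (cases "measure M N = 0")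
  case True
  have "A \<in> null_sets M" if "A \<in> regions T" for A
    using regs[OF that] True \<open>c > 0\<close> regions_sets[OF T that]
    by (auto simp: null_sets_def emeasure_eq_measure)
  then show ?thesis using bisects_null by blast
next
  case False
  then have "0 < measure M N" by (simp add: zero_less_measure_iff)
  then have "0 < measure M A" if "A \<in> regions T" for A
    using regs[OF that] \<open>c > 0\<close> by (metis zero_less_mult_pos)
  then show ?thesis by (rule bis)
qed

text \<open>The measure is kept on a fixed space and seen through a map \<open>q\<close> into \<open>E\<close>, so that projecting
it only changes \<open>q\<close>.\<close>

lemma (in finite_measure) equipartition_exists:
  fixes q :: "'a \<Rightarrow> 'b::euclidean_space"
  assumes "N \<in> sets M"
  shows "affine E \<Longrightarrow> aff_dim E = int n \<Longrightarrow> q \<in> borel_measurable M \<Longrightarrow> (\<And>\<omega>. \<omega> \<in> N \<Longrightarrow> q \<omega> \<in> E)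
    \<Longrightarrow> charges_no_hyperplane M N q E
    \<Longrightarrow> \<exists>P x. yao_yao E P x \<and> (\<forall>A\<in>P. 2 ^ n * measure M {\<omega>\<in>N. q \<omega> \<in> A} = measure M N)"
proof (induction n arbitrary: E q)
  case 0
  then obtain x where E: "E = {x}" using aff_dim_eq_0[of E] by auto
  have "{\<omega>\<in>N. q \<omega> \<in> {x}} = N" using 0 E by auto
  then show ?case unfolding E using yao_yao.base[of x] by (intro exI[of _ "{{x}}"] exI[of _ x]) auto
next
  case (Suc n)
  note qm[measurable] = Suc.prems(3)
  from Suc.prems(2) have "E \<noteq> {}" by auto
  then obtain x where "x \<in> E" by blast
  obtain F e d where F: "affine F" "x \<in> F" "e \<notin> vec_of F" "E = cylinder F e"
    "\<And>y. y \<in> F \<Longrightarrow> d \<bullet> y = d \<bullet> x" "d \<bullet> e = 1"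
    using exists_cylinder_decomposition[OF Suc.prems(1) \<open>x \<in> E\<close>] Suc.prems(2) by auto
  define \<tau> where "\<tau> = (\<lambda>\<omega>. d \<bullet> q \<omega> - d \<bullet> x)"
  define p where "p = (\<lambda>\<omega>. q \<omega> - \<tau> \<omega> *\<^sub>R e)"
  have \<tau>m[measurable]: "\<tau> \<in> borel_measurable M" unfolding \<tau>_def by measurable
  have pm[measurable]: "p \<in> borel_measurable M" unfolding p_def by measurable
  have qp: "q \<omega> = p \<omega> + \<tau> \<omega> *\<^sub>R e" for \<omega> by (simp add: p_def)
  have pF: "p \<omega> \<in> F" if \<omega>: "\<omega> \<in> N" for \<omega>
  proof -
    obtain y c where "y \<in> F" "q \<omega> = y + c *\<^sub>R e" using Suc.prems(4)[OF \<omega>] by (auto simp: F(4) cylinder_def)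
    then show ?thesis using F(5)[of y] F(6) by (simp add: p_def \<tau>_def inner_add_right)
  qed
  have pnull: "charges_no_hyperplane M N p F"
    using charges_no_hyperplane_shadow[OF F(1,3) assms order_refl qm pF qp Suc.prems(5)[unfolded F(4)]] by blast
  have "aff_dim F = int n" using aff_dim_cylinder[OF F(1) _ F(3)] F(2,4) Suc.prems(2) by force
  from Suc.IH[OF F(1) this pm pF pnull]
  obtain P y where P: "yao_yao F P y" "\<And>A. A \<in> P \<Longrightarrow> 2 ^ n * measure M {\<omega>\<in>N. p \<omega> \<in> A} = measure M N"
    by blast
  obtain T where T: "split_tree_on M T"
    "\<And>A. A \<in> regions T \<Longrightarrow> A \<subseteq> N \<and> (\<exists>B\<in>P. measure M A = measure M {\<omega>\<in>N. p \<omega> \<in> B})"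
    "\<And>u b. u \<in> borel_measurable M \<Longrightarrow>
        charges_no_hyperplane M N (\<lambda>\<omega>. p \<omega> + u \<omega> *\<^sub>R e) (cylinder F e) \<Longrightarrow> bisects M T u b \<Longrightarrow>
        (\<exists>Q. yao_yao (cylinder F e) Q (y + b *\<^sub>R e) \<and> (\<forall>A\<in>Q. \<exists>B\<in>P.
          2 * measure M {\<omega>\<in>N. p \<omega> + u \<omega> *\<^sub>R e \<in> A} = measure M {\<omega>\<in>N. p \<omega> \<in> B}))"
    using lift_partition[OF P(1) finite_measure_axioms F(3) assms pm pF pnull] by auto
  \<comment> \<open>The coordinate of \<open>q\<close> along \<open>e\<close> is the height over the
    base; each base cell carries the fraction \<open>1 / 2 ^ n\<close> of the mass.\<close>
  have "\<exists>b. bisects M T \<tau> b"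
  proof (rule bisects_ex_of_uniform[OF T(1) assms, where c = "2 ^ n"])
    show "A \<subseteq> N \<and> 2 ^ n * measure M A = measure M N" if "A \<in> regions T" for A
      using T(2)[OF that] P(2) by auto
    show "\<exists>b. bisects M T \<tau> b" if "\<And>A. A \<in> regions T \<Longrightarrow> 0 < measure M A"
      using bisects_properties[OF T(1) that] interval_bisectedD(1)[OF _ \<tau>m] by blast
  qed simp
  then obtain b where b: "bisects M T \<tau> b" by blast
  have "charges_no_hyperplane M N (\<lambda>\<omega>. p \<omega> + \<tau> \<omega> *\<^sub>R e) (cylinder F e)"
    using Suc.prems(5) F(4) qp by simp
  from T(3)[OF \<tau>m this b] obtain Q where Q: "yao_yao E Q (y + b *\<^sub>R e)"
    "\<And>A. A \<in> Q \<Longrightarrow> \<exists>B\<in>P. 2 * measure M {\<omega>\<in>N. q \<omega> \<in> A} = measure M {\<omega>\<in>N. p \<omega> \<in> B}"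
    unfolding qp[symmetric] F(4)[symmetric] by blast
  have "2 ^ Suc n * measure M {\<omega>\<in>N. q \<omega> \<in> A} = measure M N" if A: "A \<in> Q" for A
  proof -
    obtain B where "B \<in> P" "2 * measure M {\<omega>\<in>N. q \<omega> \<in> A} = measure M {\<omega>\<in>N. p \<omega> \<in> B}" using Q(2)[OF A] by blast
    with P(2)[of B] show ?thesis unfolding power_Suc2 mult.assoc by simp
  qed
  with Q(1) show ?case by blast
qed

text \<open>Only one half-space is partitioned, so at each stage the last slope is free and keeps
  the center at \<open>x\<close>. Symmetry is spent in dimension one, where it makes the two rays
  from \<open>x\<close> equally heavy; it gets there by successive projections along directions
  transversal to slices through \<open>x\<close>.\<close>

lemma (in finite_measure) symmetric_half_equipartition:
  fixes q :: "'a \<Rightarrow> 'b::euclidean_space"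
  assumes N: "N \<in> sets M"
  shows "affine E \<Longrightarrow> aff_dim E = int (Suc n) \<Longrightarrow> x \<in> E \<Longrightarrow> q \<in> borel_measurable M
    \<Longrightarrow> (\<And>\<omega>. \<omega> \<in> N \<Longrightarrow> q \<omega> \<in> E) \<Longrightarrow> charges_no_hyperplane M N q E
    \<Longrightarrow> (\<And>A. closed A \<Longrightarrow> measure M {\<omega>\<in>N. q \<omega> \<in> A} = measure M {\<omega>\<in>N. 2 *\<^sub>R x - q \<omega> \<in> A})
    \<Longrightarrow> \<exists>F v P. affine_hyperplane_of E F \<and> v \<in> vec_of E \<and> v \<notin> vec_of F \<and> yao_yao F P x
      \<and> (\<forall>A\<in>P. 2 ^ Suc n * measure M {\<omega>\<in>N. q \<omega> \<in> ray_sum_pos A v} = measure M N)"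
proof (induction n arbitrary: E q)
  case 0
  note qm[measurable] = "0.prems"(4)
  have eq: "{\<omega>\<in>N. P \<omega>} = {\<omega>\<in>space M. \<omega> \<in> N \<and> P \<omega>}" for P
    using sets.sets_into_space[OF N] by auto
  have [measurable]: "Measurable.pred M (\<lambda>\<omega>. \<omega> \<in> N)" using N by simp
  obtain F e d where F: "affine F" "x \<in> F" "e \<notin> vec_of F" "E = cylinder F e"
    "\<And>y. y \<in> F \<Longrightarrow> d \<bullet> y = d \<bullet> x" "d \<bullet> e = 1"
    using exists_cylinder_decomposition[OF "0.prems"(1,3)] "0.prems"(2) by auto
  have "aff_dim F = 0" using aff_dim_cylinder[OF F(1) _ F(3)] F(2,4) "0.prems"(2) by force
  then have Fx: "F = {x}" using F(2) by (rule aff_dim_zero_singleton)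
  define \<tau> where "\<tau> = (\<lambda>\<omega>. d \<bullet> q \<omega> - d \<bullet> x)"
  have \<tau>m[measurable]: "\<tau> \<in> borel_measurable M" unfolding \<tau>_def by measurable
  have qx: "q \<omega> = x + \<tau> \<omega> *\<^sub>R e" if \<omega>: "\<omega> \<in> N" for \<omega>
  proof -
    obtain c where "q \<omega> = x + c *\<^sub>R e" using "0.prems"(5)[OF \<omega>] by (auto simp: F(4) Fx cylinder_def)
    then show ?thesis using F(6) by (simp add: \<tau>_def inner_add_right)
  qed
  have hyp: "affine_hyperplane_of E F" unfolding F(4) using F by (intro base_hyperplane_cylinder) auto
  have pos: "measure M {\<omega>\<in>N. q \<omega> \<in> ray_sum_pos {x} e} = measure M {\<omega>\<in>N. 0 < \<tau> \<omega>}"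
    and neg: "measure M {\<omega>\<in>N. q \<omega> \<in> ray_sum_neg {x} e} = measure M {\<omega>\<in>N. \<tau> \<omega> < 0}"
    using measure_ray_sums[OF F(1,3) N qm measurable_const[of x] \<tau>m _ qx "0.prems"(6)[unfolded F(4)], of "{x}"] F(2)
    by auto
  have "e \<noteq> 0" using F(6) by auto
  have "q \<omega> \<in> F \<longleftrightarrow> \<tau> \<omega> = 0" if "\<omega> \<in> N" for \<omega>
    using \<open>e \<noteq> 0\<close> unfolding qx[OF that] Fx by simp
  then have "{\<omega>\<in>N. q \<omega> \<in> F} = {\<omega>\<in>N. \<tau> \<omega> = 0}" by blast
  moreover have "measure M {\<omega>\<in>N. q \<omega> \<in> F} = 0"
    using "0.prems"(6) hyp by (simp add: charges_no_hyperplane_def)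
  ultimately have null: "measure M {\<omega>\<in>N. \<tau> \<omega> = 0} = 0" by simp
  have cl: "closed (ray_sum_pos {x} e)" using ray_sums_closed[OF F(1,3), of "{x}"] F(2) by simp
  have "2 *\<^sub>R x - y \<in> ray_sum_pos {x} e \<longleftrightarrow> y \<in> ray_sum_neg {x} e" for y
  proof
    assume "2 *\<^sub>R x - y \<in> ray_sum_pos {x} e"
    then obtain t where "t \<ge> 0" "2 *\<^sub>R x - y = x + t *\<^sub>R e" by (auto simp: ray_sum_singleton)
    then have "y = x + (- t) *\<^sub>R e" "- t \<le> 0" by (auto simp: algebra_simps scaleR_2)
    then show "y \<in> ray_sum_neg {x} e" unfolding ray_sum_singleton by blast
  next
    assume "y \<in> ray_sum_neg {x} e"
    then obtain t where "t \<le> 0" "y = x + t *\<^sub>R e" by (auto simp: ray_sum_singleton)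
    then have "2 *\<^sub>R x - y = x + (- t) *\<^sub>R e" "- t \<ge> 0" by (auto simp: algebra_simps scaleR_2)
    then show "2 *\<^sub>R x - y \<in> ray_sum_pos {x} e" unfolding ray_sum_singleton by blast
  qed
  then have sym: "measure M {\<omega>\<in>N. q \<omega> \<in> ray_sum_pos {x} e} = measure M {\<omega>\<in>N. q \<omega> \<in> ray_sum_neg {x} e}"
    using "0.prems"(7)[OF cl] by simp
  have s: "{\<omega>\<in>N. \<tau> \<omega> < 0} \<in> sets M" "{\<omega>\<in>N. \<tau> \<omega> = 0} \<in> sets M" "{\<omega>\<in>N. \<tau> \<omega> > 0} \<in> sets M"
    unfolding eq by measurable
  have "measure M ({\<omega>\<in>N. \<tau> \<omega> < 0} \<union> {\<omega>\<in>N. \<tau> \<omega> = 0} \<union> {\<omega>\<in>N. \<tau> \<omega> > 0}) =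
      measure M ({\<omega>\<in>N. \<tau> \<omega> < 0} \<union> {\<omega>\<in>N. \<tau> \<omega> = 0}) + measure M {\<omega>\<in>N. \<tau> \<omega> > 0}"
    by (rule finite_measure_Union) (use s in auto)
  moreover have "measure M ({\<omega>\<in>N. \<tau> \<omega> < 0} \<union> {\<omega>\<in>N. \<tau> \<omega> = 0}) = measure M {\<omega>\<in>N. \<tau> \<omega> < 0}"
    by (subst finite_measure_Union; use s null in auto)
  moreover have "{\<omega>\<in>N. \<tau> \<omega> < 0} \<union> {\<omega>\<in>N. \<tau> \<omega> = 0} \<union> {\<omega>\<in>N. \<tau> \<omega> > 0} = N" by auto
  ultimately have "2 ^ Suc 0 * measure M {\<omega>\<in>N. q \<omega> \<in> ray_sum_pos {x} e} = measure M N"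
    using pos neg sym by simp
  moreover have "e \<in> vec_of E" unfolding F(4) using F by (intro vec_of_cylinder) auto
  ultimately show ?case using hyp F(3) yao_yao.base[of x] unfolding Fx by blast
next
  case (Suc n)
  note qm[measurable] = Suc.prems(4)
  obtain F e d where F: "affine F" "x \<in> F" "e \<notin> vec_of F" "E = cylinder F e"
    "\<And>y. y \<in> F \<Longrightarrow> d \<bullet> y = d \<bullet> x" "d \<bullet> e = 1"
    using exists_cylinder_decomposition[OF Suc.prems(1,3)] Suc.prems(2) by auto
  define \<pi> where "\<pi> = (\<lambda>y. y - (d \<bullet> y - d \<bullet> x) *\<^sub>R e)"
  define \<tau> where "\<tau> = (\<lambda>\<omega>. d \<bullet> q \<omega> - d \<bullet> x)"
  define p where "p = (\<lambda>\<omega>. \<pi> (q \<omega>))"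
  have \<tau>m[measurable]: "\<tau> \<in> borel_measurable M" unfolding \<tau>_def by measurable
  have pm[measurable]: "p \<in> borel_measurable M" unfolding p_def \<pi>_def by measurable
  have qp: "q \<omega> = p \<omega> + \<tau> \<omega> *\<^sub>R e" for \<omega> by (simp add: p_def \<pi>_def \<tau>_def)
  have pF: "p \<omega> \<in> F" if \<omega>: "\<omega> \<in> N" for \<omega>
  proof -
    obtain y c where "y \<in> F" "q \<omega> = y + c *\<^sub>R e" using Suc.prems(5)[OF \<omega>] by (auto simp: F(4) cylinder_def)
    then show ?thesis using F(5)[of y] F(6) by (simp add: p_def \<pi>_def inner_add_right)
  qed
  have pnull: "charges_no_hyperplane M N p F"
    using charges_no_hyperplane_shadow[OF F(1,3) N order_refl qm pF qp Suc.prems(6)[unfolded F(4)]] by blast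
  have dimF: "aff_dim F = int (Suc n)" using aff_dim_cylinder[OF F(1) _ F(3)] F(2,4) Suc.prems(2) by force
  \<comment> \<open>The projection \<open>\<pi>\<close> commutes with the reflection in
    \<open>x\<close> because its base passes through \<open>x\<close>. Symmetry is tested on closed
    sets, and their preimages under the continuous \<open>\<pi>\<close> are closed.\<close>
  have psym: "measure M {\<omega>\<in>N. p \<omega> \<in> A} = measure M {\<omega>\<in>N. 2 *\<^sub>R x - p \<omega> \<in> A}" if A: "closed A" for A
  proof -
    have "continuous_on UNIV \<pi>" unfolding \<pi>_def by (intro continuous_intros)
    then have "closed (\<pi> -` A)" using A by (simp add: closed_vimage continuous_on_eq_continuous_at)
    from Suc.prems(7)[OF this]
    have "measure M {\<omega>\<in>N. \<pi> (q \<omega>) \<in> A} = measure M {\<omega>\<in>N. \<pi> (2 *\<^sub>R x - q \<omega>) \<in> A}" by simp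
    moreover have "\<pi> (2 *\<^sub>R x - y) = 2 *\<^sub>R x - \<pi> y" for y
    proof -
      have "d \<bullet> (2 *\<^sub>R x - y) - d \<bullet> x = - (d \<bullet> y - d \<bullet> x)" by (simp add: inner_diff_right)
      moreover have "a - y - (- t) *\<^sub>R e = a - (y - t *\<^sub>R e)" for a t by simp
      ultimately show ?thesis unfolding \<pi>_def by (simp only:)
    qed
    ultimately show ?thesis by (simp add: p_def)
  qed
  from Suc.IH[OF F(1) dimF F(2) pm pF pnull psym]
  obtain G v P where G: "affine_hyperplane_of F G" "v \<in> vec_of F" "v \<notin> vec_of G" and P: "yao_yao G P x"
    "\<And>A. A \<in> P \<Longrightarrow> 2 ^ Suc n * measure M {\<omega>\<in>N. p \<omega> \<in> ray_sum_pos A v} = measure M N"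
    by blast
  have Gx: "affine G" "x \<in> G" "G \<noteq> {}" and PG: "\<And>A. A \<in> P \<Longrightarrow> closed A \<and> A \<subseteq> G"
    using yao_yao_basic[OF P(1)] by auto
  have FG: "F = cylinder G v" by (rule hyperplane_cylinder_eq[OF F(1) G(1) Gx(3) G(2,3)])
  obtain d' k where d': "\<And>y. y \<in> G \<Longrightarrow> d' \<bullet> y = k" "d' \<bullet> v = 1"
    using exists_transversal_functional[OF Gx(1,3) G(3)] by metis
  define \<sigma> where "\<sigma> = (\<lambda>\<omega>. d' \<bullet> p \<omega> - k)"
  define f where "f = (\<lambda>\<omega>. p \<omega> - \<sigma> \<omega> *\<^sub>R v)"
  have \<sigma>m[measurable]: "\<sigma> \<in> borel_measurable M" unfolding \<sigma>_def by measurable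
  have fm[measurable]: "f \<in> borel_measurable M" unfolding f_def by measurable
  have pf: "p \<omega> = f \<omega> + \<sigma> \<omega> *\<^sub>R v" for \<omega> by (simp add: f_def)
  have fG: "f \<omega> \<in> G" if \<omega>: "\<omega> \<in> N" for \<omega>
  proof -
    obtain y c where "y \<in> G" "p \<omega> = y + c *\<^sub>R v" using pF[OF \<omega>] by (auto simp: FG cylinder_def)
    then show ?thesis using d' by (simp add: f_def \<sigma>_def inner_add_right)
  qed
  let ?N = "{\<omega>\<in>N. 0 < \<sigma> \<omega>}"
  have [measurable]: "Measurable.pred M (\<lambda>\<omega>. \<omega> \<in> N)" using N by simp
  have "?N = {\<omega>\<in>space M. \<omega> \<in> N \<and> 0 < \<sigma> \<omega>}"
    using sets.sets_into_space[OF N] by auto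
  then have Ns: "?N \<in> sets M" by simp
  have eG: "e \<notin> vec_of G" using F(3) G(1) vec_of_mono[of G F] by (auto simp: affine_hyperplane_of_def)
  have fnull: "charges_no_hyperplane M ?N f G"
    by (rule charges_no_hyperplane_shadow[OF Gx(1) G(3) N _ pm fG pf pnull[unfolded FG]]) auto
  have mpos: "measure M {\<omega>\<in>N. p \<omega> \<in> ray_sum_pos A v} = measure M {\<omega>\<in>?N. f \<omega> \<in> A}" if "A \<in> P" for A
    using PG that by (intro measure_ray_sums(1)[OF Gx(1) G(3) N pm fm \<sigma>m fG pf pnull[unfolded FG]]) auto
  obtain T where T: "split_tree_on M T"
    "\<And>A. A \<in> regions T \<Longrightarrow> A \<subseteq> ?N \<and> (\<exists>B\<in>P. measure M A = measure M {\<omega>\<in>?N. f \<omega> \<in> B})"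
    "\<And>u b. u \<in> borel_measurable M \<Longrightarrow>
        charges_no_hyperplane M ?N (\<lambda>\<omega>. f \<omega> + u \<omega> *\<^sub>R e) (cylinder G e) \<Longrightarrow> bisects M T u b \<Longrightarrow>
        (\<exists>Q. yao_yao (cylinder G e) Q (x + b *\<^sub>R e) \<and> (\<forall>A\<in>Q. \<exists>B\<in>P.
          2 * measure M {\<omega>\<in>?N. f \<omega> + u \<omega> *\<^sub>R e \<in> A} = measure M {\<omega>\<in>?N. f \<omega> \<in> B}))"
    using lift_partition[OF P(1) finite_measure_axioms eG Ns fm _ fnull] fG by auto
  \<comment> \<open>The height is prescribed to be 0, so that the lifted center is \<open>x\<close>
    itself; a slope achieving this exists because \<open>\<sigma>\<close> is positive on all
    regions.\<close>
  have "\<exists>w. bisects M T (\<lambda>\<omega>. \<tau> \<omega> - w * \<sigma> \<omega>) 0"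
  proof (rule bisects_ex_of_uniform[OF T(1) N, where c = "2 ^ Suc n"])
    show "A \<subseteq> N \<and> 2 ^ Suc n * measure M A = measure M N" if A: "A \<in> regions T" for A
    proof -
      obtain B where "B \<in> P" "measure M A = measure M {\<omega>\<in>?N. f \<omega> \<in> B}" using T(2)[OF A] by blast
      then have "2 ^ Suc n * measure M A = measure M N" using P(2)[of B] mpos[of B] by simp
      with T(2)[OF A] show ?thesis by blast
    qed
    show "\<exists>w. bisects M T (\<lambda>\<omega>. \<tau> \<omega> - w * \<sigma> \<omega>) 0" if "\<And>A. A \<in> regions T \<Longrightarrow> 0 < measure M A"
      by (rule bisects_slope_ex[OF T(1) that \<tau>m \<sigma>m]) (use T(2) in auto)
  qed simp
  then obtain w where w: "bisects M T (\<lambda>\<omega>. \<tau> \<omega> - w * \<sigma> \<omega>) 0" by blast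
  let ?H = "cylinder G e" and ?v = "v + w *\<^sub>R e" and ?g = "\<lambda>\<omega>. f \<omega> + (\<tau> \<omega> - w * \<sigma> \<omega>) *\<^sub>R e"
  have aH: "affine ?H" "?H \<noteq> {}" using affine_cylinder[OF Gx(1)] subset_cylinder[of G e] Gx by auto
  have vH: "?v \<notin> vec_of ?H"
    using not_vec_of_skew_cylinder[OF Gx(1) G(3)] F(3) by (simp add: FG)
  have EH: "E = cylinder ?H ?v"
    unfolding F(4) FG by (rule cylinder_skew)
  have gm: "?g \<in> borel_measurable M" and hm: "(\<lambda>\<omega>. \<tau> \<omega> - w * \<sigma> \<omega>) \<in> borel_measurable M" by measurable
  have gH: "?g \<omega> \<in> ?H" if "\<omega> \<in> N" for \<omega> using fG[OF that] by (intro cylinderI)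
  have qg: "q \<omega> = ?g \<omega> + \<sigma> \<omega> *\<^sub>R ?v" for \<omega> using qp[of \<omega>] pf[of \<omega>] by (simp add: algebra_simps)
  have gnull: "charges_no_hyperplane M ?N ?g ?H"
    by (rule charges_no_hyperplane_shadow[OF aH(1) vH N _ qm gH qg Suc.prems(6)[unfolded EH]]) auto
  obtain Q where Q: "yao_yao ?H Q x" "\<And>A. A \<in> Q \<Longrightarrow> \<exists>B\<in>P.
        2 * measure M {\<omega>\<in>?N. ?g \<omega> \<in> A} = measure M {\<omega>\<in>?N. f \<omega> \<in> B}"
    using T(3)[OF hm gnull w] by auto
  have "2 ^ Suc (Suc n) * measure M {\<omega>\<in>N. q \<omega> \<in> ray_sum_pos A ?v} = measure M N" if A: "A \<in> Q" for A
  proof -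
    have "closed A" "A \<subseteq> ?H" using yao_yao_basic[OF Q(1)] A by auto
    then have "measure M {\<omega>\<in>N. q \<omega> \<in> ray_sum_pos A ?v} = measure M {\<omega>\<in>?N. ?g \<omega> \<in> A}"
      by (intro measure_ray_sums(1)[OF aH(1) vH N qm gm \<sigma>m gH qg Suc.prems(6)[unfolded EH]])
    moreover obtain B where "B \<in> P" "2 * measure M {\<omega>\<in>?N. ?g \<omega> \<in> A} = measure M {\<omega>\<in>?N. f \<omega> \<in> B}"
      using Q(2)[OF A] by blast
    ultimately show ?thesis using P(2)[of B] mpos[of B] unfolding power_Suc2[of _ "Suc n"] mult.assoc by simp
  qed
  moreover have "affine_hyperplane_of E ?H" unfolding EH by (rule base_hyperplane_cylinder[OF aH vH])
  moreover have "?v \<in> vec_of E" unfolding EH by (rule vec_of_cylinder[OF aH(2)])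
  ultimately show ?case using Q(1) vH by blast
qed

section \<open>Point reflections of Yao-Yao partitions and the final assembly\<close>

lemma vec_of_reflect: "vec_of ((\<lambda>y. c - y) ` S) = vec_of S"
proof -
  have sub: "vec_of ((\<lambda>y. c - y) ` S) \<subseteq> vec_of S" for S :: "'a::euclidean_space set"
    unfolding vec_of_def by auto blast
  have "(\<lambda>y. c - y) ` (\<lambda>y. c - y) ` S = S" by (simp add: image_image)
  with sub[of S] sub[of "(\<lambda>y. c - y) ` S"] show ?thesis by auto
qed

lemma reflect_eq: "(\<lambda>y. c - y) ` S = (+) c ` uminus ` S" for c :: "'a::euclidean_space"
  by (simp add: image_image)

lemma affine_reflect: "affine S \<Longrightarrow> affine ((\<lambda>y. c - y) ` S)" for c :: "'a::euclidean_space"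
  unfolding affine_def
proof safe
  fix a b :: 'a and u v :: real
  assume S: "\<forall>x\<in>S. \<forall>y\<in>S. \<forall>u v. u + v = 1 \<longrightarrow> u *\<^sub>R x + v *\<^sub>R y \<in> S" and ab: "a \<in> S" "b \<in> S" "u + v = 1"
  have "u *\<^sub>R (c - a) + v *\<^sub>R (c - b) = (u + v) *\<^sub>R c - (u *\<^sub>R a + v *\<^sub>R b)"
    by (simp add: algebra_simps)
  moreover have "u *\<^sub>R a + v *\<^sub>R b \<in> S" using S ab by blast
  ultimately show "u *\<^sub>R (c - a) + v *\<^sub>R (c - b) \<in> (\<lambda>y. c - y) ` S"
    using ab by (metis image_eqI scaleR_one)
qed

lemma aff_dim_reflect: "aff_dim ((\<lambda>y. c - y) ` S) = aff_dim S" for c :: "'a::euclidean_space"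
  unfolding reflect_eq aff_dim_translation_eq
  by (intro aff_dim_injective_linear_image) (auto intro: linear_uminus simp: inj_def)

lemma reflect_ray_sums:
  "(\<lambda>y. c - y) ` ray_sum_pos A v = ray_sum_neg ((\<lambda>y. c - y) ` A) v"
  "(\<lambda>y. c - y) ` ray_sum_neg A v = ray_sum_pos ((\<lambda>y. c - y) ` A) v"
proof -
  have "(\<lambda>y. c - y) ` ray_sum_pos A v \<subseteq> ray_sum_neg ((\<lambda>y. c - y) ` A) v" for A
  proof clarsimp
    fix z assume "z \<in> ray_sum_pos A v"
    then obtain a t where "a \<in> A" "t \<ge> 0" "z = a + t *\<^sub>R v" by (auto simp: ray_sum_pos_def)
    then have "c - a \<in> (\<lambda>y. c - y) ` A" "- t \<le> 0" "c - z = (c - a) + (- t) *\<^sub>R v" by auto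
    then show "c - z \<in> ray_sum_neg ((\<lambda>y. c - y) ` A) v" unfolding ray_sum_neg_def by blast
  qed
  moreover have "(\<lambda>y. c - y) ` ray_sum_neg A v \<subseteq> ray_sum_pos ((\<lambda>y. c - y) ` A) v" for A
  proof clarsimp
    fix z assume "z \<in> ray_sum_neg A v"
    then obtain a t where "a \<in> A" "t \<le> 0" "z = a + t *\<^sub>R v" by (auto simp: ray_sum_neg_def)
    then have "c - a \<in> (\<lambda>y. c - y) ` A" "- t \<ge> 0" "c - z = (c - a) + (- t) *\<^sub>R v" by auto
    then show "c - z \<in> ray_sum_pos ((\<lambda>y. c - y) ` A) v" unfolding ray_sum_pos_def by blast
  qed
  moreover have inv: "(\<lambda>y. c - y) ` (\<lambda>y. c - y) ` S = S" for S by (simp add: image_image)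
  ultimately show "(\<lambda>y. c - y) ` ray_sum_pos A v = ray_sum_neg ((\<lambda>y. c - y) ` A) v"
    "(\<lambda>y. c - y) ` ray_sum_neg A v = ray_sum_pos ((\<lambda>y. c - y) ` A) v"
    by (metis image_mono subset_antisym)+
qed

text \<open>A reflection reverses rays along \<open>v\<close>, so the same \<open>v\<close> can be
  kept if the partitions of the two sides exchange their roles.\<close>

lemma yao_yao_reflect:
  "yao_yao E P x \<Longrightarrow> yao_yao ((\<lambda>y. c - y) ` E) ((\<lambda>A. (\<lambda>y. c - y) ` A) ` P) (c - x)"
proof (induction rule: yao_yao.induct)
  case (base x)
  then show ?case using yao_yao.base[of "c - x"] by simp
next
  case (step E F v P1 x Pm1)
  let ?r = "\<lambda>y. c - y"
  have "yao_yao (?r ` E) ((\<lambda>A. ray_sum_neg A v) ` ((`) ?r ` P1) \<union> (\<lambda>A. ray_sum_pos A v) ` ((`) ?r ` Pm1)) (c - x)"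
    using step by (intro yao_yao.step[where F = "?r ` F"])
      (auto simp: aff_dim_reflect vec_of_reflect affine_hyperplane_of_def intro: affine_reflect)
  then show ?case by (simp add: image_Un image_image reflect_ray_sums Un_commute)
qed

theorem theorem3:
  fixes E :: "'a::euclidean_space set" and \<mu> :: "'a measure"
  assumes "affine E" and "E \<noteq> {}" and "\<mu> \<in> measures_M E"
  shows "(\<exists>P x. yao_yao_equipartition E \<mu> P x)
     \<and> (\<forall>x\<in>E. distr \<mu> \<mu> (\<lambda>y. 2 *\<^sub>R x - y) = \<mu> \<longrightarrow> yao_yao_center E \<mu> x)"
proof -
  have sets: "sets \<mu> = sets (restrict_space borel E)" and "finite_measure \<mu>"
    and hyp: "\<And>H. affine_hyperplane_of E H \<Longrightarrow> emeasure \<mu> H = 0"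
    using assms(3) by (auto simp: measures_M_def)
  interpret finite_measure \<mu> by fact
  have space: "space \<mu> = E" using sets_eq_imp_space_eq[OF sets] by (simp add: space_restrict_space)
  then have N: "E \<in> sets \<mu>" by (metis sets.top)
  have meas: "f \<in> borel_measurable \<mu>" if "f \<in> borel_measurable borel" for f :: "'a \<Rightarrow> 'a"
    using that measurable_cong_sets[OF sets refl] measurable_restrict_space1 by blast
  have null: "charges_no_hyperplane \<mu> E (\<lambda>y. y) E"
    unfolding charges_no_hyperplane_def
  proof (intro allI impI)
    fix H assume "affine_hyperplane_of E H"
    then have "{y\<in>E. y \<in> H} = H" "emeasure \<mu> H = 0" using hyp by (auto simp: affine_hyperplane_of_def)
    then show "measure \<mu> {y\<in>E. y \<in> H} = 0" by (simp add: measure_def)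
  qed
  define n where "n = nat (aff_dim E)"
  have "aff_dim E \<ge> 0" using assms(2) aff_dim_geq[of E] aff_dim_empty[of E] by linarith
  then have dim: "aff_dim E = int n" by (simp add: n_def)
  \<comment> \<open>Returns from the formulation with a map to \<open>\<mu>\<close> itself, the map
    being the identity; closedness of the cells gives their measurability.\<close>
  have equip: "yao_yao_equipartition E \<mu> P x"
    if P: "yao_yao E P x" "\<And>A. A \<in> P \<Longrightarrow> 2 ^ n * measure \<mu> {y\<in>E. y \<in> A} = measure \<mu> E" for P x
    unfolding yao_yao_equipartition_def
  proof (intro conjI ballI P(1))
    fix A assume A: "A \<in> P"
    then have "closed A" "A \<subseteq> E" using yao_yao_basic[OF P(1)] by auto
    then show "A \<in> sets \<mu>" unfolding sets by (auto simp: sets_restrict_space intro!: image_eqI[of _ _ A])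
    have "{y\<in>E. y \<in> A} = A" using \<open>A \<subseteq> E\<close> by auto
    with P(2)[OF A] show "measure \<mu> A = measure \<mu> E / 2 ^ nat (aff_dim E)"
      by (simp add: n_def field_simps)
  qed
  have "\<exists>P x. yao_yao E P x \<and> (\<forall>A\<in>P. 2 ^ n * measure \<mu> {y\<in>E. y \<in> A} = measure \<mu> E)"
    by (rule equipartition_exists[OF N assms(1) dim meas _ null]) auto
  then have "\<exists>P x. yao_yao_equipartition E \<mu> P x" using equip by blast
  moreover have "yao_yao_center E \<mu> x" if x: "x \<in> E" and sym: "distr \<mu> \<mu> (\<lambda>y. 2 *\<^sub>R x - y) = \<mu>" for x
  proof (cases n)
    \<comment> \<open>A point has no half-spaces, so dimension 0 is settled directly.\<close>
    case 0
    then have E: "E = {x}" using dim x aff_dim_zero_singleton[of E x] by simp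
    have "yao_yao_equipartition E \<mu> {{x}} x"
      by (rule equip) (use 0 E yao_yao.base[of x] in auto)
    then show ?thesis by (auto simp: yao_yao_center_def)
  next
    case (Suc m)
    let ?r = "\<lambda>y. 2 *\<^sub>R x - y"
    have rS: "?r y \<in> S" if "affine S" "x \<in> S" "y \<in> S" for S y
    proof -
      have "2 *\<^sub>R x + (- 1) *\<^sub>R y \<in> S" by (rule mem_affine[OF that]) simp
      then show ?thesis by simp
    qed
    have rm: "?r \<in> measurable \<mu> \<mu>"
    proof -
      have "?r \<in> measurable \<mu> (restrict_space borel E)"
        using rS[OF assms(1) x] by (intro measurable_restrict_space2 meas) (auto simp: space)
      then show ?thesis using measurable_cong_sets[OF refl sets] by blast
    qed
    have symA: "measure \<mu> {y\<in>E. y \<in> A} = measure \<mu> {y\<in>E. ?r y \<in> A}" if A: "closed A" for A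
    proof -
      have s: "{y\<in>E. y \<in> A} \<in> sets \<mu>" using sets_preimage_closed[OF N meas A, of "\<lambda>y. y"] by simp
      have "measure \<mu> {y\<in>E. y \<in> A} = measure (distr \<mu> \<mu> ?r) {y\<in>E. y \<in> A}" by (simp add: sym)
      also have "\<dots> = measure \<mu> (?r -` {y\<in>E. y \<in> A} \<inter> space \<mu>)" by (rule measure_distr[OF rm s])
      also have "?r -` {y\<in>E. y \<in> A} \<inter> space \<mu> = {y\<in>E. ?r y \<in> A}"
        using rS[OF assms(1) x] by (auto simp: space)
      finally show ?thesis .
    qed
    have "\<exists>F v P. affine_hyperplane_of E F \<and> v \<in> vec_of E \<and> v \<notin> vec_of F \<and> yao_yao F P x
      \<and> (\<forall>A\<in>P. 2 ^ Suc m * measure \<mu> {y\<in>E. y \<in> ray_sum_pos A v} = measure \<mu> E)"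
      by (rule symmetric_half_equipartition[OF N assms(1) _ x meas _ null symA]) (use dim Suc in auto)
    then obtain F v P where F: "affine_hyperplane_of E F" "v \<in> vec_of E" "v \<notin> vec_of F" "yao_yao F P x"
      and P: "\<And>A. A \<in> P \<Longrightarrow> 2 ^ n * measure \<mu> {y\<in>E. y \<in> ray_sum_pos A v} = measure \<mu> E"
      unfolding Suc by blast
    have aF: "affine F" "x \<in> F" and clP: "\<And>A. A \<in> P \<Longrightarrow> closed A \<and> A \<subseteq> F"
      using yao_yao_basic[OF F(4)] by auto
    \<comment> \<open>A flat through \<open>x\<close> is mapped onto itself by the reflection in
      \<open>x\<close>. So the reflected partition lives on the same \<open>F\<close> with the same
      center, as the two partitions in the inductive definition must.\<close>
    have "?r ` F = F"
    proof
      show "?r ` F \<subseteq> F" using rS[OF aF] by auto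
      then have "?r ` ?r ` F \<subseteq> ?r ` F" by (rule image_mono)
      then show "F \<subseteq> ?r ` F" by (simp add: image_image)
    qed
    moreover have "2 *\<^sub>R x - x = x" by (simp add: scaleR_2)
    ultimately have "yao_yao F ((`) ?r ` P) x" using yao_yao_reflect[OF F(4), of "2 *\<^sub>R x"] by simp
    then have yao: "yao_yao E ((\<lambda>A. ray_sum_neg A v) ` ((`) ?r ` P) \<union> (\<lambda>A. ray_sum_pos A v) ` P) x"
      using F assms(1) dim Suc by (intro yao_yao.step) auto
    \<comment> \<open>Reflection carries the cells of the positive half to those of the negative
      half, and invariance of the measure transfers their masses.\<close>
    have "2 ^ n * measure \<mu> {y\<in>E. y \<in> ray_sum_neg (?r ` A) v} = measure \<mu> E" if A: "A \<in> P" for A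
    proof -
      have "closed (ray_sum_pos A v)" using ray_sums_closed[OF aF(1) F(3)] clP[OF A] by blast
      moreover have "?r y \<in> ray_sum_pos A v \<longleftrightarrow> y \<in> ray_sum_neg (?r ` A) v" for y
        unfolding reflect_ray_sums(1)[symmetric] by (auto simp: image_iff) (metis diff_diff_eq2 add_diff_cancel_left')
      ultimately show ?thesis using symA[of "ray_sum_pos A v"] P[OF A] by simp
    qed
    with P have "2 ^ n * measure \<mu> {y\<in>E. y \<in> A} = measure \<mu> E"
      if "A \<in> (\<lambda>A. ray_sum_neg A v) ` ((`) ?r ` P) \<union> (\<lambda>A. ray_sum_pos A v) ` P" for A
      using that by auto
    then show ?thesis using equip[OF yao] by (auto simp: yao_yao_center_def)
  qed
  ultimately show ?thesis by blast
qed

end
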